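(* Let $A \in \mathbb{R}^{n\times n}$, $B = [B_1, \dots, B_m] \in \mathbb{R}^{n\times m}$ (columns $B_i$), $F \in \mathbb{R}^{n \times l}_+$, $H \in \mathbb{R}^{n \times c}$, $E = [E_1^{\top}, \dots, E_m^{\top}]^{\top} \in \mathbb{R}_{+}^{m \times n}$ (rows $E_i$) such that $E_i^{\top} \neq 0$ for all $i$, $G\in \mathbb{R}^{c \times n}_{+}$, $s \in \mathbb{R}^{n}$, $r \in \mathbb{R}^{m}$, $\gamma \in \mathbb{R}^{l}_{+}$ and $\delta \in \mathbb{R}^{c}$. Suppose that $A-|B|E-|H|G$ is Metzler and that $s \geq E^{\top}|r| - G^{\top}|\delta|$. Consider the infinite-horizon optimal control problem $$\inf_{\mu}\ \sup_{w,v}\ \int_0^\infty \left[s^{\top}x(\tau)+r^{\top}u(\tau)-\gamma^{\top}w(\tau)-\delta^{\top}v(\tau)\right]d\tau$$ subject to $\dot x(t)=Ax(t)+Bu(t)+Fw(t)+Hv(t)$, $x(0)=x_0$, $x_0\in\mathbb{R}^n_+$, $u(t)=\mu(x(t))$, $|u|\le Ex$, $w\ge 0$, $|v|\le Gx$. Then the following statements are equivalent: (i) The optimal control problem has a finite value for every $x_0\in\mathbb{R}^n_+$. (ii) There exists a unique $p\in\mathbb{R}^n_+$ such that $$A^{\top}p = E^{\top}\left|r+B^{\top}p\right| - G^{\top}\left|-\delta+H^{\top}p\right| - s \qquad\text{and}\qquad \gamma\ge F^{\top}p,$$ which is minimal among all solutions $\hat p$ of these two relations in the sense that $p\le\hat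 p$. Moreover, if (i)--(ii) are satisfied, then the infinite-horizon minimax control problem has minimum value $p^{\top}x_0$, and the control law $u(t)=-Kx(t)$ is optimal when $$K\in\begin{bmatrix}\operatorname{sign}(r_1+p^{\top}B_1)E_1\\ \vdots\\ \operatorname{sign}(r_m+p^{\top}B_m)E_m\end{bmatrix}.$$
   Context: Inequalities between vectors or matrices are elementwise, $|X|$ denotes the elementwise absolute value, and $\mathbb{R}^n_+$, $\mathbb{R}^{m\times n}_+$ denote vectors/matrices with nonnegative entries. A square matrix is Metzler if its off-diagonal entries are nonnegative. The signum is set-valued: $\operatorname{sign}(y)=\{+1\}$ if $y>0$, $\{-1\}$ if $y<0$, and $[-1,1]$ if $y=0$; the inclusion for $K$ means that the $i$-th row of $K$ is $\sigma E_i$ for some $\sigma\in\operatorname{sign}(r_i+p^{\top}B_i)$. In the optimal control problem, $x(t)\in\mathbb{R}^n$ is the state, $\mu$ ranges over (potentially nonlinear) control policies producing a control $u(t)\in\mathbb{R}^m$ with $|u(t)|\le Ex(t)$, and the disturbances $w$ and $v$ satisfy $w(t)\in\mathbb{R}^l$, $w(t)\ge 0$ and $v(t)\in\mathbb{R}^c$, $|v(t)|\le Gx(t)$.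
   Formalization: Minimality of p in (ii) is taken only among nonnegative solutions p̂; among all real solutions the claim fails, e.g. in dimension one with A=0, B=E=r=s=1 and G=H=δ=F=γ=0, where the value is 0 but p̂=−2 also solves the relations. *)

theory Defs
  imports "HOL-Analysis.Analysis"
begin

text \<open>
  On the types \<^typ>\<open>real^'n\<close> and \<^typ>\<open>real^'n^'m\<close> the library's order \<open>\<le>\<close>, absolute value
  and product \<open>*\<close> are all elementwise; the matrix products are \<open>*v\<close> and \<open>**\<close>.
\<close>

definition metzler :: "real^'n^'n \<Rightarrow> bool" where
  "metzler M \<longleftrightarrow> (\<forall>i j. i \<noteq> j \<longrightarrow> 0 \<le> M $ i $ j)"

definition sign_set :: "real \<Rightarrow> real set" where
  "sign_set y = (if y > 0 then {1} else if y < 0 then {-1} else {-1..1})"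

definition locally_integrable :: "(real \<Rightarrow> 'a::euclidean_space) \<Rightarrow> bool" where
  "locally_integrable f \<longleftrightarrow> (\<forall>T. f absolutely_integrable_on {0..T})"

text \<open>
  Solutions of the differential equation are understood in the sense of Caratheodory, that is,
  through the equivalent integral equation; the case \<open>t = 0\<close> of that equation is the initial
  condition \<open>x 0 = x0\<close>.
\<close>

definition trajectory ::
  "real^'n^'n \<Rightarrow> real^'m^'n \<Rightarrow> real^'l^'n \<Rightarrow> real^'c^'n \<Rightarrow> real^'n^'m \<Rightarrow> real^'n^'c \<Rightarrow>
   real^'n \<Rightarrow> (real \<Rightarrow> real^'n) \<Rightarrow> (real \<Rightarrow> real^'m) \<Rightarrow> (real \<Rightarrow> real^'l) \<Rightarrow> (real \<Rightarrow> real^'c) \<Rightarrow> bool"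
where
  "trajectory A B F H E G x0 x u w v \<longleftrightarrow>
     locally_integrable u \<and> locally_integrable w \<and> locally_integrable v \<and>
     (\<forall>t\<ge>0. ((\<lambda>\<tau>. A *v x \<tau> + B *v u \<tau> + F *v w \<tau> + H *v v \<tau>) has_integral (x t - x0)) {0..t}) \<and>
     (\<forall>t\<ge>0. \<bar>u t\<bar> \<le> E *v x t \<and> 0 \<le> w t \<and> \<bar>v t\<bar> \<le> G *v x t)"

text \<open>
  A policy is an arbitrary state feedback that respects the control constraint on the nonnegative
  orthant and whose closed loop has a solution for all initial states and disturbances (otherwise
  a supremum over an empty set of trajectories could make the policy spuriously cheap; solutions
  need not be unique).  Since the constraint \<open>\<bar>v\<bar> \<le> G x\<close> involves the state, which is not
  known before the loop is closed, the disturbance is prescribed here through its ratio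
  \<open>d\<close> to the bound \<open>G x\<close>, where \<open>d\<close> is any measurable signal with \<open>\<bar>d\<bar> \<le> 1\<close>.
\<close>

definition admissible_policy ::
  "real^'n^'n \<Rightarrow> real^'m^'n \<Rightarrow> real^'l^'n \<Rightarrow> real^'c^'n \<Rightarrow> real^'n^'m \<Rightarrow> real^'n^'c \<Rightarrow>
   (real^'n \<Rightarrow> real^'m) \<Rightarrow> bool"
where
  "admissible_policy A B F H E G \<mu> \<longleftrightarrow>
     (\<forall>x\<ge>0. \<bar>\<mu> x\<bar> \<le> E *v x) \<and>
     (\<forall>x0\<ge>0. \<forall>w d. locally_integrable w \<and> (\<forall>t\<ge>0. 0 \<le> w t) \<and>
        locally_integrable d \<and> (\<forall>t\<ge>0. \<bar>d t\<bar> \<le> 1) \<longrightarrow>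
        (\<exists>x. trajectory A B F H E G x0 x (\<lambda>t. \<mu> (x t)) w (\<lambda>t. d t * (G *v x t))))"

text \<open>
  The improper integral need not converge for every disturbance.  It is taken as the upper limit
  of the finite-horizon costs, so that no disturbance is discarded; this is the usual value
  (possibly infinite) whenever the limit exists.
\<close>

definition total_cost ::
  "real^'n \<Rightarrow> real^'m \<Rightarrow> real^'l \<Rightarrow> real^'c \<Rightarrow>
   (real \<Rightarrow> real^'n) \<Rightarrow> (real \<Rightarrow> real^'m) \<Rightarrow> (real \<Rightarrow> real^'l) \<Rightarrow> (real \<Rightarrow> real^'c) \<Rightarrow> ereal"
where
  "total_cost s r \<gamma> \<delta> x u w v =
     Limsup at_top (\<lambda>T. ereal (integral {0..T}
       (\<lambda>\<tau>. s \<bullet> x \<tau> + r \<bullet> u \<tau> - \<gamma> \<bullet> w \<tau> - \<delta> \<bullet> v \<tau>)))"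

definition worst_case_cost ::
  "real^'n^'n \<Rightarrow> real^'m^'n \<Rightarrow> real^'l^'n \<Rightarrow> real^'c^'n \<Rightarrow> real^'n^'m \<Rightarrow> real^'n^'c \<Rightarrow>
   real^'n \<Rightarrow> real^'m \<Rightarrow> real^'l \<Rightarrow> real^'c \<Rightarrow> (real^'n \<Rightarrow> real^'m) \<Rightarrow> real^'n \<Rightarrow> ereal"
where
  "worst_case_cost A B F H E G s r \<gamma> \<delta> \<mu> x0 =
     Sup {total_cost s r \<gamma> \<delta> x (\<lambda>t. \<mu> (x t)) w v | x w v.
            trajectory A B F H E G x0 x (\<lambda>t. \<mu> (x t)) w v}"

definition minimax_value ::
  "real^'n^'n \<Rightarrow> real^'m^'n \<Rightarrow> real^'l^'n \<Rightarrow> real^'c^'n \<Rightarrow> real^'n^'m \<Rightarrow> real^'n^'c \<Rightarrow>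
   real^'n \<Rightarrow> real^'m \<Rightarrow> real^'l \<Rightarrow> real^'c \<Rightarrow> real^'n \<Rightarrow> ereal"
where
  "minimax_value A B F H E G s r \<gamma> \<delta> x0 =
     (INF \<mu>\<in>{\<mu>. admissible_policy A B F H E G \<mu>}. worst_case_cost A B F H E G s r \<gamma> \<delta> \<mu> x0)"

definition optimal_policy ::
  "real^'n^'n \<Rightarrow> real^'m^'n \<Rightarrow> real^'l^'n \<Rightarrow> real^'c^'n \<Rightarrow> real^'n^'m \<Rightarrow> real^'n^'c \<Rightarrow>
   real^'n \<Rightarrow> real^'m \<Rightarrow> real^'l \<Rightarrow> real^'c \<Rightarrow> (real^'n \<Rightarrow> real^'m) \<Rightarrow> bool"
where
  "optimal_policy A B F H E G s r \<gamma> \<delta> \<mu> \<longleftrightarrow>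
     admissible_policy A B F H E G \<mu> \<and>
     (\<forall>x0\<ge>0. worst_case_cost A B F H E G s r \<gamma> \<delta> \<mu> x0 = minimax_value A B F H E G s r \<gamma> \<delta> x0)"

definition bellman_solution ::
  "real^'n^'n \<Rightarrow> real^'m^'n \<Rightarrow> real^'l^'n \<Rightarrow> real^'c^'n \<Rightarrow> real^'n^'m \<Rightarrow> real^'n^'c \<Rightarrow>
   real^'n \<Rightarrow> real^'m \<Rightarrow> real^'l \<Rightarrow> real^'c \<Rightarrow> real^'n \<Rightarrow> bool"
where
  "bellman_solution A B F H E G s r \<gamma> \<delta> p \<longleftrightarrow>
     0 \<le> p \<and>
     transpose A *v p =
       transpose E *v \<bar>r + transpose B *v p\<bar> - transpose G *v \<bar>- \<delta> + transpose H *v p\<bar> - s \<and>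
     transpose F *v p \<le> \<gamma>"

text \<open>
  Minimality is among the nonnegative solutions: with one state, one input,
  \<open>A = 0\<close>, \<open>B = E = r = s = 1\<close>, \<open>G = 0\<close>, \<open>H = 0\<close> and \<open>\<delta> = 0\<close>, the equation is also solved by
  \<open>p = -2\<close>, although the value of the problem is \<open>0\<close>.
\<close>

definition minimal_bellman_solution ::
  "real^'n^'n \<Rightarrow> real^'m^'n \<Rightarrow> real^'l^'n \<Rightarrow> real^'c^'n \<Rightarrow> real^'n^'m \<Rightarrow> real^'n^'c \<Rightarrow>
   real^'n \<Rightarrow> real^'m \<Rightarrow> real^'l \<Rightarrow> real^'c \<Rightarrow> real^'n \<Rightarrow> bool"
where
  "minimal_bellman_solution A B F H E G s r \<gamma> \<delta> p \<longleftrightarrow>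
     bellman_solution A B F H E G s r \<gamma> \<delta> p \<and>
     (\<forall>q. bellman_solution A B F H E G s r \<gamma> \<delta> q \<longrightarrow> p \<le> q)"

end

theory Submission
  imports Defs
begin

text \<open>
  The map \<open>bellman p = s + A\<^sup>T p - E\<^sup>T \<bar>r + B\<^sup>T p\<bar> + G\<^sup>T \<bar>H\<^sup>T p - \<delta>\<bar>\<close> becomes monotone after adding
  a multiple \<open>l p\<close>, because \<open>A - \<bar>B\<bar> E - \<bar>H\<bar> G\<close> is Metzler, and it is nonnegative at \<open>0\<close>.  Hence
  \<open>p \<mapsto> p + h bellman p\<close> with \<open>h = (1 - exp (- l)) / l\<close> is monotone, and its iterates \<open>val k\<close> from \<open>0\<close>
  increase towards the minimal nonnegative zero of \<open>bellman\<close>, if there is one.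

  Lower bound: against any policy the disturbance \<open>w = 0\<close>, \<open>v = sgn (H\<^sup>T p - \<delta>) G x\<close> with
  \<open>p = val (n - k)\<close> held constant on the time interval from \<open>k\<close> to \<open>k + 1\<close> costs the controller at
  least \<open>val (n + 1) \<bullet> x0\<close>, so a finite value bounds the iterates.  A large constant \<open>w\<close> on the
  first interval makes this cost unbounded unless \<open>F\<^sup>T val n \<le> \<gamma>\<close>.

  Upper bound: if \<open>bellman p = 0\<close> and \<open>F\<^sup>T p \<le> \<gamma>\<close>, then under \<open>u = - K x\<close> the running cost plus the
  derivative of \<open>p \<bullet> x\<close> is nonpositive, and \<open>p \<bullet> x \<ge> 0\<close> since trajectories stay in the orthant.
\<close>

section \<open>Elementwise order\<close>

lemma abs_vec_nth: "\<bar>x\<bar> $ i = \<bar>x $ i\<bar>"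
  by (simp add: abs_vec_def)

lemma matrix_vector_mult_nonneg:
  fixes M :: "real^'n^'m"
  assumes "0 \<le> M" "0 \<le> x"
  shows "0 \<le> M *v x"
  using assms by (auto simp: less_eq_vec_def matrix_vector_mult_def intro!: sum_nonneg)

lemma matrix_vector_mult_mono:
  fixes M :: "real^'n^'m"
  assumes "0 \<le> M" "x \<le> y"
  shows "M *v x \<le> M *v y"
  using matrix_vector_mult_nonneg[of M "y - x"] assms by (simp add: matrix_vector_mult_diff_distrib)

lemma abs_matrix_vector_mult_le:
  fixes M :: "real^'n^'m"
  shows "\<bar>M *v x\<bar> \<le> \<bar>M\<bar> *v \<bar>x\<bar>"
  unfolding less_eq_vec_def
  by (auto simp: matrix_vector_mult_def abs_vec_nth abs_mult intro!: order_trans[OF sum_abs] sum_mono)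

lemma inner_mono_nonneg:
  fixes x y z :: "real^'n"
  assumes "x \<le> y" "0 \<le> z"
  shows "x \<bullet> z \<le> y \<bullet> z"
  using assms by (auto simp: less_eq_vec_def inner_vec_def intro!: sum_mono mult_right_mono)

lemma abs_inner_le:
  fixes x y :: "real^'n"
  shows "\<bar>x \<bullet> y\<bar> \<le> \<bar>x\<bar> \<bullet> \<bar>y\<bar>"
  by (auto simp: inner_vec_def abs_vec_nth abs_mult intro!: order_trans[OF sum_abs] sum_mono)

lemma inner_le_abs_inner:
  fixes z v y :: "real^'n"
  assumes "\<bar>v\<bar> \<le> y"
  shows "z \<bullet> v \<le> \<bar>z\<bar> \<bullet> y"
proof -
  have "z \<bullet> v \<le> \<bar>z\<bar> \<bullet> \<bar>v\<bar>" using abs_inner_le[of z v] by linarith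
  also have "\<dots> \<le> \<bar>z\<bar> \<bullet> y" using inner_mono_nonneg[OF assms, of "\<bar>z\<bar>"] by (simp add: inner_commute)
  finally show ?thesis .
qed

lemma matrix_nonneg_transpose: "0 \<le> M \<Longrightarrow> 0 \<le> transpose M" for M :: "real^'n^'m"
  by (simp add: less_eq_vec_def transpose_def)

lemma abs_transpose: "\<bar>transpose M\<bar> = transpose \<bar>M\<bar>" for M :: "real^'n^'m"
  by (simp add: vec_eq_iff abs_vec_nth transpose_def)

text \<open>Only diagonal entries can be negative, so adding a multiple of the identity larger than
  all of them in absolute value gives a nonnegative matrix. The transpose has the same diagonal,
  hence one \<open>l\<close> serves both.\<close>

lemma metzler_shift:
  fixes M :: "real^'n^'n"
  assumes "metzler M"
  obtains l where "0 < l" "\<And>x. 0 \<le> x \<Longrightarrow> 0 \<le> M *v x + l *\<^sub>R x" "\<And>x. 0 \<le> x \<Longrightarrow> 0 \<le> transpose M *v x + l *\<^sub>R x"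
proof -
  define l where "l = 1 + (\<Sum>i\<in>UNIV. \<bar>M $ i $ i\<bar>)"
  define N where "N = M + mat l"
  have l: "l \<ge> \<bar>M $ i $ i\<bar> + 1" for i
    unfolding l_def using member_le_sum[of i UNIV "\<lambda>i. \<bar>M $ i $ i\<bar>"] by simp
  have "0 \<le> N $ i $ j" for i j
    using assms l[of i] by (auto simp: N_def mat_def metzler_def)
  then have N: "0 \<le> N" by (simp add: less_eq_vec_def)
  have ml: "mat l *v x = l *\<^sub>R x" for x :: "real^'n"
    by (simp add: vec_eq_iff matrix_vector_mult_def mat_def if_distrib[of "\<lambda>a. a * _"] cong: if_cong)
  have "transpose N = transpose M + mat l"
    by (simp add: vec_eq_iff N_def transpose_def mat_def)
  then have "0 \<le> transpose M *v x + l *\<^sub>R x" if "0 \<le> x" for x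
    using matrix_vector_mult_nonneg[OF matrix_nonneg_transpose[OF N] that]
    by (metis matrix_vector_mult_add_rdistrib ml)
  moreover have "0 \<le> M *v x + l *\<^sub>R x" if "0 \<le> x" for x
    using matrix_vector_mult_nonneg[OF N that]
    by (simp add: N_def matrix_vector_mult_add_rdistrib ml)
  moreover have "0 < l" using l[of undefined] by linarith
  ultimately show thesis using that by blast
qed

section \<open>Row vectors times matrices, the simplified form of products with a transpose\<close>

lemma vector_matrix_mult_nonneg:
  fixes M :: "real^'n^'m"
  assumes "0 \<le> M" "0 \<le> x"
  shows "0 \<le> x v* M"
  using matrix_vector_mult_nonneg[OF matrix_nonneg_transpose[OF assms(1)] assms(2)] by simp

lemma vector_matrix_mult_mono:
  fixes M :: "real^'n^'m"
  assumes "0 \<le> M" "x \<le> y"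
  shows "x v* M \<le> y v* M"
  using matrix_vector_mult_mono[OF matrix_nonneg_transpose[OF assms(1)] assms(2)] by simp

lemma abs_vector_matrix_mult_le:
  fixes M :: "real^'n^'m"
  shows "\<bar>x v* M\<bar> \<le> \<bar>x\<bar> v* \<bar>M\<bar>"
  using abs_matrix_vector_mult_le[of "transpose M" x] by (simp add: abs_transpose)

lemma vector_matrix_mult_linear: "linear (\<lambda>x. x v* M)" for M :: "real^'n^'m"
  using matrix_vector_mul_linear[of "transpose M"] by simp

lemmas vector_matrix_mult_diff = linear_diff[OF vector_matrix_mult_linear]

lemma vector_matrix_mult_assoc: "x v* (M ** N) = (x v* M) v* N"
  for M :: "real^'n^'m" and N :: "real^'k^'n"
  by (metis matrix_transpose_mul matrix_vector_mul_assoc transpose_matrix_vector)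

lemma vector_matrix_mult_diff_right: "x v* (M - N) = x v* M - x v* N" for M :: "real^'n^'m"
  by (simp add: vec_eq_iff vector_matrix_mult_def algebra_simps sum_subtractf)

lemma abs_le_iff_vec: "\<bar>x\<bar> \<le> y \<longleftrightarrow> (\<forall>i. \<bar>x $ i\<bar> \<le> y $ i)" for x y :: "real^'n"
  by (simp add: less_eq_vec_def abs_vec_nth)

lemma inner_vec_mult_commute: "z \<bullet> (d * x) = (d * z) \<bullet> x" for x z d :: "real^'n"
  by (simp add: inner_vec_def mult_ac)

text \<open>The worst-case ratio: among all \<open>v\<close> with
  \<open>\<bar>v\<bar> \<le> y\<close>, the product \<open>z \<bullet> v\<close> is largest at
  \<open>v = sgn_vec z * y\<close>.\<close>

definition sgn_vec :: "real^'n \<Rightarrow> real^'n" where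
  "sgn_vec z = (\<chi> i. sgn (z $ i))"

lemma sgn_vec_mult: "sgn_vec z * z = \<bar>z\<bar>"
  by (simp add: vec_eq_iff sgn_vec_def abs_vec_nth abs_sgn mult.commute)

lemma abs_sgn_vec_le: "\<bar>sgn_vec z\<bar> \<le> 1"
  by (simp add: abs_le_iff_vec sgn_vec_def abs_sgn_eq)

section \<open>Integral equations\<close>

lemma absolutely_integrable_bilinear_continuous:
  fixes f :: "real \<Rightarrow> 'a::euclidean_space" and g :: "real \<Rightarrow> 'b::euclidean_space"
    and h :: "'a \<Rightarrow> 'b \<Rightarrow> 'c::euclidean_space"
  assumes "bilinear h" "continuous_on {a..b} f" "g absolutely_integrable_on {a..b}"
  shows "(\<lambda>t. h (f t) (g t)) absolutely_integrable_on {a..b}"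
proof (rule absolutely_integrable_bounded_measurable_product[OF assms(1)])
  show "f \<in> borel_measurable (lebesgue_on {a..b})"
    by (rule continuous_imp_measurable_on_sets_lebesgue[OF assms(2)]) simp
  show "bounded (f ` {a..b})"
    using assms(2) by (intro compact_imp_bounded compact_continuous_image) auto
qed (use assms in auto)

lemma has_integral_imp_continuous_on:
  fixes X :: "real \<Rightarrow> 'a::banach"
  assumes "\<And>t. t \<in> {a..b} \<Longrightarrow> (g has_integral (X t - x0)) {a..t}"
  shows "continuous_on {a..b} X"
proof (cases "a \<le> b")
  case True
  show ?thesis
  proof (rule continuous_on_eq)
    have "g integrable_on {a..b}" using assms[of b] True by auto
    then show "continuous_on {a..b} (\<lambda>t. x0 + integral {a..t} g)"
      by (intro continuous_intros indefinite_integral_continuous_1)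
    show "x0 + integral {a..t} g = X t" if "t \<in> {a..b}" for t
      using integral_unique[OF assms[OF that]] by simp
  qed
qed simp

text \<open>
  Here \<open>X\<close> is only absolutely continuous and may fail to be differentiable on an uncountable set, so
  the integration by parts of the library does not apply.  However, the difference \<open>D\<close> of the two
  sides has derivative \<open>0\<close> everywhere: on an interval of length \<open>h\<close> it changes by at most
  a constant times \<open>h\<close> times the sum of the oscillation of \<open>X\<close> and the integral of \<open>norm g\<close>.
\<close>

lemma has_integral_product_rule:
  fixes X g :: "real \<Rightarrow> 'a::euclidean_space" and \<phi> \<phi>' :: "real \<Rightarrow> real"
  assumes ab: "a \<le> b"
    and g: "g absolutely_integrable_on {a..b}"
    and X: "\<And>t. t \<in> {a..b} \<Longrightarrow> (g has_integral (X t - X a)) {a..t}"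
    and \<phi>: "\<And>t. (\<phi> has_vector_derivative \<phi>' t) (at t)"
    and c\<phi>': "continuous_on UNIV \<phi>'"
  shows "((\<lambda>t. \<phi>' t *\<^sub>R X t + \<phi> t *\<^sub>R g t) has_integral (\<phi> b *\<^sub>R X b - \<phi> a *\<^sub>R X a)) {a..b}"
proof -
  have c\<phi>: "continuous_on S \<phi>" for S
    by (meson \<phi> continuous_on_eq_continuous_within continuous_at_imp_continuous_at_within has_vector_derivative_continuous)
  have gi: "g integrable_on {s..t}" if "a \<le> s" "t \<le> b" for s t
    using g that by (meson absolutely_integrable_on_subinterval atLeastatMost_subset_iff set_lebesgue_integral_eq_integral(1))
  have ngi: "(\<lambda>t. norm (g t)) integrable_on {s..t}" if "a \<le> s" "t \<le> b" for s t
    using absolutely_integrable_on_subinterval[OF g, of s t] that by (auto simp: absolutely_integrable_on_def)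
  have Xst: "(g has_integral (X t - X s)) {s..t}" if "a \<le> s" "s \<le> t" "t \<le> b" for s t
  proof -
    have "integral {a..s} g + integral {s..t} g = integral {a..t} g"
      using that gi[of a t] by (intro Henstock_Kurzweil_Integration.integral_combine) auto
    moreover have "integral {a..s} g = X s - X a" "integral {a..t} g = X t - X a"
      using X that by (auto intro!: integral_unique)
    ultimately have "integral {s..t} g = X t - X s" by (simp add: algebra_simps)
    then show ?thesis using gi[of s t] that by (metis has_integral_integral)
  qed
  have cX: "continuous_on {a..b} X"
    by (rule has_integral_imp_continuous_on[OF X])
  \<comment> \<open>\<open>g\<close> may be unbounded, so its contribution on short intervals is
    controlled through the uniform continuity of \<open>Y\<close>.\<close>
  define Y where "Y t = integral {a..t} (\<lambda>t. norm (g t))" for t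
  have cY: "continuous_on {a..b} Y"
    unfolding Y_def using ngi[of a b] ab by (intro indefinite_integral_continuous_1) auto
  define f where "f t = \<phi>' t *\<^sub>R X t + \<phi> t *\<^sub>R g t" for t
  have f: "f integrable_on {s..t}" if "a \<le> s" "t \<le> b" for s t
  proof -
    have "f absolutely_integrable_on {a..b}"
      unfolding f_def
    proof (rule set_integral_add(1))
      show "(\<lambda>t. \<phi>' t *\<^sub>R X t) absolutely_integrable_on {a..b}"
        by (intro absolutely_integrable_continuous_real continuous_intros cX continuous_on_subset[OF c\<phi>']) auto
      show "(\<lambda>t. \<phi> t *\<^sub>R g t) absolutely_integrable_on {a..b}"
        by (rule absolutely_integrable_bilinear_continuous[OF _ c\<phi> g])
          (simp add: bilinear_conv_bounded_bilinear bounded_bilinear_scaleR)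
    qed
    then show ?thesis using that
      by (meson absolutely_integrable_on_subinterval atLeastatMost_subset_iff set_lebesgue_integral_eq_integral(1))
  qed
  define D where "D t = integral {a..t} f - \<phi> t *\<^sub>R X t" for t
  obtain C where C: "\<And>t. t \<in> {a..b} \<Longrightarrow> \<bar>\<phi>' t\<bar> \<le> C" and "0 < C"
  proof -
    have "bounded (\<phi>' ` {a..b})"
      by (intro compact_imp_bounded compact_continuous_image continuous_on_subset[OF c\<phi>']) auto
    then show ?thesis using that unfolding bounded_pos by (metis imageI real_norm_def)
  qed
  have lip: "\<bar>\<phi> t - \<phi> s\<bar> \<le> C * \<bar>t - s\<bar>" if "s \<in> {a..b}" "t \<in> {a..b}" for s t
  proof -
    have "norm (\<phi> t - \<phi> s) \<le> C * norm (t - s)"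
    proof (rule field_differentiable_bound)
      show "(\<phi> has_field_derivative \<phi>' z) (at z within {a..b})" for z
        using \<phi>[of z] by (simp add: has_real_derivative_iff_has_vector_derivative has_vector_derivative_at_within)
    qed (use that C in auto)
    then show ?thesis by simp
  qed
  have D_diff: "norm (D t - D s) \<le> 2 * C * \<eta> * (t - s)"
    if st: "a \<le> s" "s \<le> t" "t \<le> b" and \<eta>X: "\<And>\<tau>. \<tau> \<in> {s..t} \<Longrightarrow> norm (X \<tau> - X s) \<le> \<eta>"
      and \<eta>Y: "Y t - Y s \<le> \<eta>" for s t \<eta>
  proof -
    \<comment> \<open>Freezing \<open>X\<close> at \<open>s\<close> and \<open>\<phi>\<close> at
      \<open>t\<close> inside \<open>f\<close> gives an integrand whose integral is exactly
      \<open>\<phi> t *\<^sub>R X t - \<phi> s *\<^sub>R X s\<close>. So \<open>D t - D s\<close> is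
      the integral of the remainder \<open>k\<close>, and each of its two terms contains a small
      factor.\<close>
    define k where "k \<tau> = \<phi>' \<tau> *\<^sub>R (X \<tau> - X s) + (\<phi> \<tau> - \<phi> t) *\<^sub>R g \<tau>" for \<tau>
    have "(f has_integral (integral {a..t} f - integral {a..s} f)) {s..t}"
    proof -
      have "integral {a..s} f + integral {s..t} f = integral {a..t} f"
        using st f[of a t] by (intro Henstock_Kurzweil_Integration.integral_combine) auto
      then show ?thesis using f[of s t] st by (metis add_diff_cancel_left' has_integral_integral)
    qed
    moreover have "((\<lambda>\<tau>. \<phi> t *\<^sub>R g \<tau>) has_integral \<phi> t *\<^sub>R (X t - X s)) {s..t}"
      by (intro has_integral_cmul Xst st)
    moreover have "((\<lambda>\<tau>. \<phi>' \<tau> *\<^sub>R X s) has_integral (\<phi> t - \<phi> s) *\<^sub>R X s) {s..t}"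
      using st \<phi> by (intro has_integral_scaleR_left fundamental_theorem_of_calculus)
        (auto intro: has_vector_derivative_at_within)
    ultimately have "((\<lambda>\<tau>. f \<tau> - \<phi> t *\<^sub>R g \<tau> - \<phi>' \<tau> *\<^sub>R X s) has_integral
        ((integral {a..t} f - integral {a..s} f) - \<phi> t *\<^sub>R (X t - X s) - (\<phi> t - \<phi> s) *\<^sub>R X s)) {s..t}"
      by (intro has_integral_diff)
    moreover have "(integral {a..t} f - integral {a..s} f) - \<phi> t *\<^sub>R (X t - X s) - (\<phi> t - \<phi> s) *\<^sub>R X s = D t - D s"
      by (simp add: D_def algebra_simps)
    moreover have "(\<lambda>\<tau>. f \<tau> - \<phi> t *\<^sub>R g \<tau> - \<phi>' \<tau> *\<^sub>R X s) = k"
      by (simp add: f_def k_def algebra_simps fun_eq_iff)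
    ultimately have k: "(k has_integral (D t - D s)) {s..t}" by simp
    have ng: "((\<lambda>\<tau>. norm (g \<tau>)) has_integral (Y t - Y s)) {s..t}"
    proof -
      have "integral {a..s} (\<lambda>t. norm (g t)) + integral {s..t} (\<lambda>t. norm (g t)) = Y t"
        unfolding Y_def using st ngi[of a t] by (intro Henstock_Kurzweil_Integration.integral_combine) auto
      then show ?thesis using ngi[of s t] st
        by (metis Y_def add_diff_cancel_left' has_integral_integral)
    qed
    have "((\<lambda>\<tau>. C * \<eta> + C * (t - s) * norm (g \<tau>)) has_integral (C * \<eta> * (t - s) + C * (t - s) * (Y t - Y s))) {s..t}"
      using has_integral_add[OF has_integral_const_real[of "C * \<eta>" s t] has_integral_mult_right[OF ng, of "C * (t - s)"]] st
      by (simp add: mult.commute mult.left_commute)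
    moreover have "norm (k \<tau>) \<le> C * \<eta> + C * (t - s) * norm (g \<tau>)" if "\<tau> \<in> {s..t}" for \<tau>
    proof -
      have "norm (k \<tau>) \<le> \<bar>\<phi>' \<tau>\<bar> * norm (X \<tau> - X s) + \<bar>\<phi> \<tau> - \<phi> t\<bar> * norm (g \<tau>)"
        unfolding k_def by (rule order_trans[OF norm_triangle_ineq]) simp
      also have "\<dots> \<le> C * \<eta> + C * (t - s) * norm (g \<tau>)"
      proof (intro add_mono mult_mono mult_right_mono)
        have "\<bar>\<phi> \<tau> - \<phi> t\<bar> \<le> C * \<bar>\<tau> - t\<bar>" using lip[of t \<tau>] that st by auto
        also have "\<dots> \<le> C * (t - s)" using that \<open>0 < C\<close> by (intro mult_left_mono) auto
        finally show "\<bar>\<phi> \<tau> - \<phi> t\<bar> \<le> C * (t - s)" .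
      qed (use C[of \<tau>] \<eta>X[OF that] that st \<open>0 < C\<close> in auto)
      finally show ?thesis .
    qed
    ultimately have "norm (D t - D s) \<le> C * \<eta> * (t - s) + C * (t - s) * (Y t - Y s)"
      using k integral_norm_bound_integral[of k "{s..t}"] by (metis has_integral_integrable integral_unique)
    also have "C * (t - s) * (Y t - Y s) \<le> C * (t - s) * \<eta>"
      using \<eta>Y \<open>0 < C\<close> st by (intro mult_left_mono) auto
    finally show ?thesis by (simp add: algebra_simps)
  qed
  have "(D has_derivative (\<lambda>_. 0)) (at t within {a..b})" if "t \<in> {a..b}" for t
    unfolding has_derivative_within_alt
  proof (intro conjI allI impI)
    fix e :: real assume "0 < e"
    \<comment> \<open>Chosen so that the constant \<open>2 * C * \<eta>\<close> of
      \<open>D_diff\<close> becomes \<open>e\<close>.\<close>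
    define \<eta> where "\<eta> = e / (2 * C)"
    have "0 < \<eta>" using \<open>0 < e\<close> \<open>0 < C\<close> by (simp add: \<eta>_def)
    have "uniformly_continuous_on {a..b} X" "uniformly_continuous_on {a..b} Y"
      using cX cY by (auto intro: compact_uniformly_continuous)
    then obtain dX dY where d: "0 < dX" "0 < dY"
      "\<And>s t. s \<in> {a..b} \<Longrightarrow> t \<in> {a..b} \<Longrightarrow> dist s t < dX \<Longrightarrow> dist (X s) (X t) < \<eta>"
      "\<And>s t. s \<in> {a..b} \<Longrightarrow> t \<in> {a..b} \<Longrightarrow> dist s t < dY \<Longrightarrow> dist (Y s) (Y t) < \<eta>"
      using \<open>0 < \<eta>\<close> unfolding uniformly_continuous_on_def by metis
    have *: "norm (D v - D u) \<le> e * (v - u)" if "u \<in> {a..b}" "v \<in> {a..b}" "u \<le> v" "v - u < min dX dY" for u v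
    proof -
      have "norm (D v - D u) \<le> 2 * C * \<eta> * (v - u)"
      proof (rule D_diff)
        show "norm (X \<tau> - X u) \<le> \<eta>" if "\<tau> \<in> {u..v}" for \<tau>
          using d(3)[of \<tau> u] that \<open>u \<in> {a..b}\<close> \<open>v \<in> {a..b}\<close> \<open>v - u < min dX dY\<close>
          by (auto simp: dist_norm)
        show "Y v - Y u \<le> \<eta>" using d(4)[of v u] that by (auto simp: dist_norm)
      qed (use that in auto)
      then show ?thesis using \<open>0 < C\<close> by (simp add: \<eta>_def)
    qed
    show "\<exists>d>0. \<forall>y\<in>{a..b}. norm (y - t) < d \<longrightarrow> norm (D y - D t - 0) \<le> e * norm (y - t)"
    proof (intro exI[of _ "min dX dY"] conjI ballI impI)
      fix y assume y: "y \<in> {a..b}" "norm (y - t) < min dX dY"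
      show "norm (D y - D t - 0) \<le> e * norm (y - t)"
      proof (cases "t \<le> y")
        case True
        then show ?thesis using *[of t y] y \<open>t \<in> {a..b}\<close> by simp
      next
        case False
        then show ?thesis using *[of y t] y \<open>t \<in> {a..b}\<close> by (simp add: norm_minus_commute)
      qed
    qed (use d in auto)
  qed simp
  then have "D b = D a"
    using has_derivative_zero_unique[of "{a..b}" D b a] ab by auto
  then have "integral {a..b} f = \<phi> b *\<^sub>R X b - \<phi> a *\<^sub>R X a"
    by (simp add: D_def algebra_simps)
  then show ?thesis
    using f[of a b] unfolding f_def by (metis has_integral_integral order_refl)
qed

section \<open>Componentwise integral inequalities and positive systems\<close>

lemma has_integral_vec_nth:
  fixes f :: "'a::euclidean_space \<Rightarrow> real^'n"
  assumes "(f has_integral I) S"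
  shows "((\<lambda>x. f x $ i) has_integral (I $ i)) S"
  using has_integral_linear[OF assms bounded_linear_vec_nth[of i]] by (simp add: o_def)

lemma has_integral_vec_le:
  fixes f g :: "real \<Rightarrow> real^'n"
  assumes "(f has_integral I) S" "(g has_integral J) S" "\<And>x. x \<in> S \<Longrightarrow> f x \<le> g x"
  shows "I \<le> J"
  unfolding less_eq_vec_def
  using has_integral_le[OF has_integral_vec_nth[OF assms(1)] has_integral_vec_nth[OF assms(2)]] assms(3)
  by (auto simp: less_eq_vec_def)

lemma has_integral_exp_mult:
  fixes c :: real
  assumes "c \<noteq> 0" "a \<le> b"
  shows "((\<lambda>t. exp (c * t)) has_integral ((exp (c * b) - exp (c * a)) / c)) {a..b}"
proof -
  have "((\<lambda>t. exp (c * t)) has_integral (exp (c * b) / c - exp (c * a) / c)) {a..b}"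
    using assms
    by (intro fundamental_theorem_of_calculus)
      (auto intro!: derivative_eq_intros simp: has_real_derivative_iff_has_vector_derivative[symmetric])
  then show ?thesis by (simp add: diff_divide_distrib)
qed

text \<open>
  At the point where a component of \<open>exp ((l - \<mu>) t) X t\<close> attains a negative minimum, integrating
  \<open>(exp (l t) X t)'\<close> up to that point gives a larger value once \<open>\<mu>\<close> exceeds the row sums of \<open>M + l\<close>.
\<close>

lemma metzler_comparison:
  fixes X g :: "real \<Rightarrow> real^'n"
  assumes M: "metzler M" and x0: "0 \<le> x0"
    and g: "g absolutely_integrable_on {0..T}"
    and X: "\<And>t. t \<in> {0..T} \<Longrightarrow> (g has_integral (X t - x0)) {0..t}"
    and le: "\<And>t. t \<in> {0..T} \<Longrightarrow> M *v X t \<le> g t"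
    and t: "t \<in> {0..T}"
  shows "0 \<le> X t"
proof (rule ccontr)
  assume neg: "\<not> 0 \<le> X t"
  obtain l where l: "0 < l" "\<And>x. 0 \<le> x \<Longrightarrow> 0 \<le> M *v x + l *\<^sub>R x"
    using metzler_shift[OF M] by metis
  define one :: "real^'n" where "one = (\<chi> i. 1)"
  \<comment> \<open>\<open>C\<close> bounds every row sum of \<open>M + l\<close>, since multiplying
    by \<open>one\<close> produces the row sums.\<close>
  define C where "C = (\<Sum>i\<in>UNIV. \<bar>(M *v one + l *\<^sub>R one) $ i\<bar>)"
  define \<mu> where "\<mu> = C + 1"
  have "0 \<le> C" unfolding C_def by (intro sum_nonneg) auto
  then have "0 < \<mu>" by (simp add: \<mu>_def)
  have C: "(M *v one + l *\<^sub>R one) $ i \<le> C" for i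
    unfolding C_def using member_le_sum[of i UNIV "\<lambda>i. \<bar>(M *v one + l *\<^sub>R one) $ i\<bar>"]
    by (smt (verit) UNIV_I abs_ge_zero finite)
  define z where "z t = exp ((l - \<mu>) * t) *\<^sub>R X t" for t
  have "continuous_on {0..T} z"
    unfolding z_def by (intro continuous_intros has_integral_imp_continuous_on[OF X])
  then have "\<exists>\<tau>\<in>{0..T}. \<forall>\<sigma>\<in>{0..T}. z \<tau> $ i \<le> z \<sigma> $ i" for i
    using t by (intro continuous_attains_inf continuous_intros) auto
  then obtain \<tau> where \<tau>: "\<And>i. \<tau> i \<in> {0..T}" "\<And>i \<sigma>. \<sigma> \<in> {0..T} \<Longrightarrow> z (\<tau> i) $ i \<le> z \<sigma> $ i"
    by metis
  \<comment> \<open>\<open>c\<close> is the minimum of \<open>z\<close> over all components and all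
    times together. It is attained by component \<open>i\<close> at the time called
    \<open>T'\<close> below.\<close>
  define c where "c = Min (range (\<lambda>i. z (\<tau> i) $ i))"
  have "c \<in> range (\<lambda>i. z (\<tau> i) $ i)" unfolding c_def by (intro Min_in) auto
  then obtain i where i: "c = z (\<tau> i) $ i" by blast
  have c: "c \<le> z \<sigma> $ j" if "\<sigma> \<in> {0..T}" for \<sigma> j
  proof -
    have "c \<le> z (\<tau> j) $ j" unfolding c_def by (intro Min_le) auto
    then show ?thesis using \<tau>(2)[OF that, of j] by simp
  qed
  have "c < 0"
  proof -
    obtain j where "X t $ j < 0" using neg by (auto simp: less_eq_vec_def not_le)
    then have "z t $ j < 0" by (simp add: z_def mult_pos_neg)
    then show ?thesis using c[OF t, of j] by simp
  qed
  define T' where "T' = \<tau> i"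
  have T': "T' \<in> {0..T}" using \<tau> by (simp add: T'_def)
  define k where "k s = exp (l * s) *\<^sub>R (l *\<^sub>R X s + g s)" for s
  have X0: "X 0 = x0" using X[of 0] t by (auto simp: has_integral_refl(1) dest: has_integral_unique)
  have "((\<lambda>s. (l * exp (l * s)) *\<^sub>R X s + exp (l * s) *\<^sub>R g s) has_integral
      (exp (l * T') *\<^sub>R X T' - exp (l * 0) *\<^sub>R X 0)) {0..T'}"
    using T' X g X0
    by (intro has_integral_product_rule)
      (auto intro!: derivative_eq_intros continuous_intros absolutely_integrable_on_subinterval[OF g]
        simp: has_real_derivative_iff_has_vector_derivative[symmetric])
  then have k: "(k has_integral (exp (l * T') *\<^sub>R X T' - x0)) {0..T'}"
    by (rule has_integral_eq_rhs[OF has_integral_eq[rotated]]) (simp_all add: k_def X0 algebra_simps)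
  have "((\<lambda>s. exp (\<mu> * s)) has_integral ((exp (\<mu> * T') - 1) / \<mu>)) {0..T'}"
    using has_integral_exp_mult[of \<mu> 0 T'] \<open>0 < \<mu>\<close> T' by simp
  then have "((\<lambda>s. c * C * exp (\<mu> * s)) has_integral (c * C * ((exp (\<mu> * T') - 1) / \<mu>))) {0..T'}"
    by (rule has_integral_mult_right)
  moreover have "c * C * exp (\<mu> * s) \<le> k s $ i" if "s \<in> {0..T'}" for s
  proof -
    have s: "s \<in> {0..T}" using that T' by auto
    \<comment> \<open>\<open>y\<close> lies above \<open>c * exp (\<mu> * s)\<close> times
      \<open>one\<close>, and \<open>M + l\<close> preserves this order. So the integrand is at
      least \<open>c * exp (\<mu> * s)\<close> times a row sum, and replacing the row sum by the
      larger \<open>C\<close> only decreases this because \<open>c < 0\<close>.\<close>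
    define y where "y = exp (l * s) *\<^sub>R X s"
    have "0 \<le> y - (c * exp (\<mu> * s)) *\<^sub>R one"
    proof -
      have "y = exp (\<mu> * s) *\<^sub>R z s"
        by (simp add: y_def z_def exp_add[symmetric] algebra_simps)
      then show ?thesis using c[OF s] by (simp add: less_eq_vec_def one_def mult.commute)
    qed
    from l(2)[OF this] have "(c * exp (\<mu> * s)) *\<^sub>R (M *v one + l *\<^sub>R one) \<le> M *v y + l *\<^sub>R y"
      by (simp add: algebra_simps matrix_vector_mult_diff_distrib matrix_vector_mult_scaleR)
    also have "M *v y + l *\<^sub>R y = exp (l * s) *\<^sub>R (l *\<^sub>R X s + M *v X s)"
      by (simp add: y_def algebra_simps matrix_vector_mult_scaleR)
    also have "\<dots> \<le> k s"
      unfolding k_def using le[OF s] by (intro scaleR_left_mono add_left_mono) auto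
    finally have "c * exp (\<mu> * s) * (M *v one + l *\<^sub>R one) $ i \<le> k s $ i"
      by (simp add: less_eq_vec_def)
    moreover have "c * exp (\<mu> * s) * C \<le> c * exp (\<mu> * s) * (M *v one + l *\<^sub>R one) $ i"
      using C[of i] \<open>c < 0\<close> by (intro mult_left_mono_neg) (auto simp: mult_le_0_iff)
    ultimately show ?thesis by (simp add: mult_ac)
  qed
  ultimately have "c * C * ((exp (\<mu> * T') - 1) / \<mu>) \<le> (exp (l * T') *\<^sub>R X T' - x0) $ i"
    using has_integral_le has_integral_vec_nth[OF k, of i] by blast
  also have "\<dots> \<le> exp (l * T') * X T' $ i" using x0 by (simp add: less_eq_vec_def)
  also have "\<dots> = c * exp (\<mu> * T')"
    unfolding i T'_def[symmetric] by (simp add: z_def exp_add[symmetric] algebra_simps)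
  finally have "c * (C * (exp (\<mu> * T') - 1)) \<le> c * (exp (\<mu> * T') * \<mu>)"
    using \<open>0 < \<mu>\<close> by (simp add: field_simps)
  \<comment> \<open>Cancelling the negative \<open>c\<close> reverses the inequality; with
    \<open>\<mu> = C + 1\<close> it cannot hold.\<close>
  then have "exp (\<mu> * T') * \<mu> \<le> C * (exp (\<mu> * T') - 1)"
    using \<open>c < 0\<close> by (simp add: mult_le_cancel_left)
  then have "exp (\<mu> * T') + C \<le> 0" by (simp add: \<mu>_def algebra_simps)
  then show False using exp_gt_zero[of "\<mu> * T'"] \<open>0 \<le> C\<close> by linarith
qed

text \<open>Multiplying by \<open>exp (l t)\<close> makes the system monotone, so that the Picard iteration started
  at \<open>0\<close> increases.\<close>

lemma positive_linear_system_solution: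
  fixes \<Phi> :: "real \<Rightarrow> real^'n \<Rightarrow> real^'n" and b :: "real \<Rightarrow> real^'n"
  assumes lin: "\<And>t. linear (\<Phi> t)"
    and pos: "\<And>t x. 0 \<le> t \<Longrightarrow> 0 \<le> x \<Longrightarrow> 0 \<le> \<Phi> t x + l *\<^sub>R x"
    and bound: "\<And>t i. 0 \<le> t \<Longrightarrow> (\<Phi> t (\<chi> i. 1)) $ i + l \<le> C"
    and int: "\<And>T y. continuous_on {0..T} y \<Longrightarrow> (\<lambda>t. \<Phi> t (y t)) absolutely_integrable_on {0..T}"
    and b: "\<And>T. b absolutely_integrable_on {0..T}" "\<And>t. 0 \<le> t \<Longrightarrow> 0 \<le> b t"
    and x0: "0 \<le> x0"
  shows "\<exists>X. \<forall>t\<ge>0. 0 \<le> X t \<and> ((\<lambda>\<tau>. \<Phi> \<tau> (X \<tau>) + b \<tau>) has_integral (X t - x0)) {0..t}"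
proof -
  define one :: "real^'n" where "one = (\<chi> i. 1)"
  \<comment> \<open>\<open>D\<close> is the growth rate in the exponential bound on the iterates;
    taking \<open>\<bar>C\<bar> + 1\<close> instead of \<open>C\<close> makes it positive, so that
    it can be divided by.\<close>
  define D where "D = \<bar>C\<bar> + 1"
  have "0 < D" by (simp add: D_def)
  define \<Psi> where "\<Psi> t y = \<Phi> t y + l *\<^sub>R y" for t y
  have \<Psi>_lin: "linear (\<Psi> t)" for t
    unfolding \<Psi>_def[abs_def] by (intro linear_compose_add lin linear_scaleR)
  have \<Psi>_nonneg: "0 \<le> \<Psi> t y" if "0 \<le> t" "0 \<le> y" for t y
    using pos[OF that] by (simp add: \<Psi>_def)
  have \<Psi>_mono: "\<Psi> t x \<le> \<Psi> t y" if "0 \<le> t" "x \<le> y" for t x y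
    using \<Psi>_nonneg[of t "y - x"] that by (simp add: linear_diff[OF \<Psi>_lin])
  have \<Psi>_one: "\<Psi> t (c *\<^sub>R one) \<le> (c * D) *\<^sub>R one" if "0 \<le> t" "0 \<le> c" for t c
  proof -
    have "\<Psi> t one $ i \<le> D" for i
      using bound[OF that(1), of i] by (simp add: \<Psi>_def one_def D_def)
    then show ?thesis
      using that by (simp add: linear_scale[OF \<Psi>_lin] less_eq_vec_def one_def mult_left_mono)
  qed
  define \<beta> where "\<beta> t = exp (l * t) *\<^sub>R b t" for t
  have \<beta>: "\<beta> absolutely_integrable_on {0..T}" for T
    unfolding \<beta>_def[abs_def]
    by (rule absolutely_integrable_bilinear_continuous[OF _ _ b(1)])
      (auto simp: bilinear_conv_bounded_bilinear bounded_bilinear_scaleR intro!: continuous_intros)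
  have \<beta>_nonneg: "0 \<le> \<beta> t" if "0 \<le> t" for t
    using b(2)[OF that] by (simp add: \<beta>_def scaleR_nonneg_nonneg)
  have \<Psi>\<beta>: "(\<lambda>\<tau>. \<Psi> \<tau> (y \<tau>) + \<beta> \<tau>) absolutely_integrable_on {0..T}" if "continuous_on {0..T} y" for y T
    unfolding \<Psi>_def
    by (intro set_integral_add(1) \<beta> int that absolutely_integrable_continuous_real continuous_intros)
  define P where "P y t = x0 + integral {0..t} (\<lambda>\<tau>. \<Psi> \<tau> (y \<tau>) + \<beta> \<tau>)" for y t
  have P: "((\<lambda>\<tau>. \<Psi> \<tau> (y \<tau>) + \<beta> \<tau>) has_integral (P y t - x0)) {0..t}" if "continuous_on {0..t} y" for y t
    using \<Psi>\<beta>[OF that] set_lebesgue_integral_eq_integral(1) by (auto simp: P_def)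
  define y where "y k = (P ^^ k) (\<lambda>_. 0)" for k
  have y0: "y 0 = (\<lambda>_. 0)" and ySuc: "y (Suc k) = P (y k)" for k by (simp_all add: y_def)
  have cy: "continuous_on {0..T} (y k)" for k T
  proof (induction k)
    case (Suc k)
    show ?case unfolding ySuc
      by (rule has_integral_imp_continuous_on[OF P]) (auto intro: continuous_on_subset[OF Suc])
  qed (simp add: y0)
  have y_int: "((\<lambda>\<tau>. \<Psi> \<tau> (y k \<tau>) + \<beta> \<tau>) has_integral (y (Suc k) t - x0)) {0..t}" for k t
    unfolding ySuc by (rule P[OF cy])
  have y_nonneg: "0 \<le> y k t" if "0 \<le> t" for k t
    using that
  proof (induction k arbitrary: t)
    case (Suc k)
    have "0 \<le> y (Suc k) t - x0"
      by (rule has_integral_vec_le[OF has_integral_0 y_int])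
        (auto intro!: add_nonneg_nonneg \<Psi>_nonneg \<beta>_nonneg Suc)
    then show ?case using x0 by (simp add: order_trans[of 0 x0])
  qed (simp add: y0)
  have y_mono: "y k t \<le> y (Suc k) t" if "0 \<le> t" for k t
    using that
  proof (induction k arbitrary: t)
    case 0
    then show ?case using y_nonneg[of t "Suc 0"] by (simp add: y0)
  next
    case (Suc k)
    have "y (Suc k) t - x0 \<le> y (Suc (Suc k)) t - x0"
      by (rule has_integral_vec_le[OF y_int y_int]) (auto intro!: \<Psi>_mono Suc)
    then show ?case by simp
  qed
  \<comment> \<open>A Gronwall-type bound uniform in \<open>k\<close>. If \<open>y k\<close> is at
    most \<open>c * exp (D * t)\<close> in each component, then the next iterate is at most
    \<open>x0 + integral {0..t} \<beta>\<close> plus \<open>c * exp (D * t) - c\<close>. The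
    constant \<open>c\<close> is the sum of the nonnegative components of
    \<open>x0 + integral {0..T} \<beta>\<close>, hence at least each of them, and it absorbs the
    first term.\<close>
  have "\<exists>c\<ge>0. \<forall>t\<in>{0..T}. \<forall>k. y k t \<le> (c * exp (D * t)) *\<^sub>R one" if "0 \<le> T" for T
  proof -
    define c where "c = (\<Sum>i\<in>UNIV. (x0 + integral {0..T} \<beta>) $ i)"
    have \<beta>i: "\<beta> integrable_on {0..t}" for t
      using \<beta> set_lebesgue_integral_eq_integral(1) by blast
    have nn: "0 \<le> integral {0..t} \<beta>" if "0 \<le> t" for t
      by (rule has_integral_vec_le[OF has_integral_0 integrable_integral[OF \<beta>i]]) (simp add: \<beta>_nonneg)
    have x0\<beta>: "x0 + integral {0..t} \<beta> \<le> c *\<^sub>R one" if "t \<in> {0..T}" for t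
    proof -
      have "integral {0..t} \<beta> + integral {t..T} \<beta> = integral {0..T} \<beta>"
        using that \<beta>i by (intro Henstock_Kurzweil_Integration.integral_combine) auto
      moreover have "0 \<le> integral {t..T} \<beta>"
        using that \<beta>i[of T]
        by (intro has_integral_vec_le[OF has_integral_0 integrable_integral])
          (auto simp: \<beta>_nonneg intro: integrable_on_subinterval)
      ultimately have "x0 + integral {0..t} \<beta> \<le> x0 + integral {0..T} \<beta>"
        by (metis add_left_mono le_add_same_cancel1)
      also have "\<dots> \<le> c *\<^sub>R one"
        using x0 nn[OF \<open>0 \<le> T\<close>] unfolding c_def
        by (auto simp: less_eq_vec_def one_def simp del: sum.distrib intro!: member_le_sum)
      finally show ?thesis .
    qed
    have "0 \<le> c"
      unfolding c_def using x0 nn[OF \<open>0 \<le> T\<close>] by (intro sum_nonneg) (simp add: less_eq_vec_def)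
    have "\<forall>t\<in>{0..T}. y k t \<le> (c * exp (D * t)) *\<^sub>R one" for k
    proof (induction k)
      case 0
      then show ?case using \<open>0 \<le> c\<close> by (simp add: y0 less_eq_vec_def one_def)
    next
      case (Suc k)
      show ?case
      proof
        fix t assume t: "t \<in> {0..T}"
        have "((\<lambda>\<tau>. (c * D * exp (D * \<tau>)) *\<^sub>R one + \<beta> \<tau>) has_integral
            ((c * D * ((exp (D * t) - exp (D * 0)) / D)) *\<^sub>R one + integral {0..t} \<beta>)) {0..t}"
          using t \<open>0 < D\<close>
          by (intro has_integral_add has_integral_scaleR_left has_integral_mult_right
              has_integral_exp_mult integrable_integral \<beta>i) auto
        from y_int this
        have "y (Suc k) t - x0 \<le> (c * D * ((exp (D * t) - exp (D * 0)) / D)) *\<^sub>R one + integral {0..t} \<beta>"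
        proof (rule has_integral_vec_le)
          fix \<tau> assume \<tau>: "\<tau> \<in> {0..t}"
          have "\<Psi> \<tau> (y k \<tau>) \<le> \<Psi> \<tau> ((c * exp (D * \<tau>)) *\<^sub>R one)"
            using Suc \<tau> t by (intro \<Psi>_mono) auto
          also have "\<dots> \<le> (c * D * exp (D * \<tau>)) *\<^sub>R one"
            using \<Psi>_one[of \<tau> "c * exp (D * \<tau>)"] \<tau> \<open>0 \<le> c\<close> by (simp add: mult_ac)
          finally show "\<Psi> \<tau> (y k \<tau>) + \<beta> \<tau> \<le> (c * D * exp (D * \<tau>)) *\<^sub>R one + \<beta> \<tau>" by simp
        qed
        also have "c * D * ((exp (D * t) - exp (D * 0)) / D) = c * exp (D * t) - c"
          using \<open>0 < D\<close> by (simp add: field_simps)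
        finally have "y (Suc k) t \<le> (c * exp (D * t) - c) *\<^sub>R one + (x0 + integral {0..t} \<beta>)"
          by (simp add: algebra_simps)
        also have "\<dots> \<le> (c * exp (D * t) - c) *\<^sub>R one + c *\<^sub>R one"
          by (intro add_left_mono x0\<beta> t)
        finally show "y (Suc k) t \<le> (c * exp (D * t)) *\<^sub>R one" by (simp add: algebra_simps)
      qed
    qed
    then show ?thesis using \<open>0 \<le> c\<close> by blast
  qed
  then obtain c where c: "\<And>T. 0 \<le> T \<Longrightarrow> 0 \<le> c T"
      "\<And>T t k. t \<in> {0..T} \<Longrightarrow> y k t \<le> (c T * exp (D * t)) *\<^sub>R one"
    by (metis atLeastAtMost_iff order_trans)
  define Y where "Y t = (\<chi> i. lim (\<lambda>k. y k t $ i))" for t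
  have lim: "(\<lambda>k. y k t) \<longlonglongrightarrow> Y t" if "0 \<le> t" for t
  proof (rule vec_tendstoI)
    fix i
    have "incseq (\<lambda>k. y k t $ i)"
      using y_mono[OF that] by (intro incseq_SucI) (simp add: less_eq_vec_def)
    moreover have "y k t $ i \<le> c t * exp (D * t)" for k
      using c(2)[of t t k] that by (simp add: less_eq_vec_def one_def)
    ultimately have "convergent (\<lambda>k. y k t $ i)"
      by (metis convergentI incseq_convergent)
    then show "(\<lambda>k. y k t $ i) \<longlonglongrightarrow> Y t $ i"
      by (simp add: Y_def convergent_LIMSEQ_iff)
  qed
  have Y_int: "((\<lambda>\<tau>. \<Psi> \<tau> (Y \<tau>) + \<beta> \<tau>) has_integral (Y t - x0)) {0..t}" if "0 \<le> t" for t
  proof -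
    \<comment> \<open>An integrable majorant for dominated convergence; the factor
      \<open>CARD('n)\<close> comes from estimating the norm by the sum of the components.\<close>
    define h where "h \<tau> = (real CARD('n) * (c t * D)) * exp (D * \<tau>) + norm (\<beta> \<tau>)" for \<tau>
    have h: "h integrable_on {0..t}"
    proof -
      have "(\<lambda>\<tau>. norm (\<beta> \<tau>)) integrable_on {0..t}"
        using \<beta>[of t] by (simp add: absolutely_integrable_on_def)
      then show ?thesis
        unfolding h_def by (intro integrable_add) (auto intro!: integrable_continuous_real continuous_intros)
    qed
    have nb: "norm (\<Psi> \<tau> (y k \<tau>) + \<beta> \<tau>) \<le> h \<tau>" if "\<tau> \<in> {0..t}" for k \<tau>
    proof -
      have "0 \<le> \<Psi> \<tau> (y k \<tau>)" using that by (intro \<Psi>_nonneg y_nonneg) auto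
      moreover have "\<Psi> \<tau> (y k \<tau>) \<le> (c t * exp (D * \<tau>) * D) *\<^sub>R one"
      proof -
        have "\<Psi> \<tau> (y k \<tau>) \<le> \<Psi> \<tau> ((c t * exp (D * \<tau>)) *\<^sub>R one)"
          using c(2)[OF that] that by (intro \<Psi>_mono) auto
        also have "\<dots> \<le> (c t * exp (D * \<tau>) * D) *\<^sub>R one"
          using c(1)[of t] that by (intro \<Psi>_one) auto
        finally show ?thesis .
      qed
      ultimately have "\<bar>\<Psi> \<tau> (y k \<tau>) $ i\<bar> \<le> c t * exp (D * \<tau>) * D" for i
        by (simp add: less_eq_vec_def one_def)
      then have "norm (\<Psi> \<tau> (y k \<tau>)) \<le> (\<Sum>i\<in>(UNIV :: 'n set). c t * exp (D * \<tau>) * D)"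
        by (intro order_trans[OF norm_le_l1_cart] sum_mono)
      then show ?thesis
        unfolding h_def by (intro order_trans[OF norm_triangle_ineq]) (simp add: mult_ac)
    qed
    have conv: "(\<lambda>k. \<Psi> \<tau> (y k \<tau>) + \<beta> \<tau>) \<longlonglongrightarrow> \<Psi> \<tau> (Y \<tau>) + \<beta> \<tau>" if "\<tau> \<in> {0..t}" for \<tau>
      using that by (intro tendsto_add tendsto_const linear_continuous_on lim
          bounded_linear.tendsto[OF linear_conv_bounded_linear[THEN iffD1, OF \<Psi>_lin]]) auto
    note dc = dominated_convergence[OF has_integral_integrable[OF y_int] h nb conv]
    have "(\<lambda>k. y (Suc k) t - x0) \<longlonglongrightarrow> Y t - x0"
      by (intro tendsto_intros LIMSEQ_Suc lim that)
    then have "integral {0..t} (\<lambda>\<tau>. \<Psi> \<tau> (Y \<tau>) + \<beta> \<tau>) = Y t - x0"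
      using dc(2) LIMSEQ_unique by (simp add: integral_unique[OF y_int])
    then show ?thesis using dc(1) by (metis has_integral_integral)
  qed
  have Y_nonneg: "0 \<le> Y t" if "0 \<le> t" for t
    using y_nonneg[OF that] tendsto_lowerbound[OF tendsto_vec_nth[OF lim[OF that]], of 0]
    by (simp add: less_eq_vec_def)
  have Y0: "Y 0 = x0" using Y_int[of 0] by (auto dest: has_integral_unique simp: has_integral_refl(1))
  \<comment> \<open>This undoes the factor \<open>exp (l * t)\<close>: in the product rule, the term
    from differentiating \<open>exp (- l * t)\<close> cancels the shift \<open>l *\<^sub>R y\<close>
    inside \<open>\<Psi>\<close>.\<close>
  define X where "X t = exp (- l * t) *\<^sub>R Y t" for t
  have "((\<lambda>\<tau>. \<Phi> \<tau> (X \<tau>) + b \<tau>) has_integral (X t - x0)) {0..t}" if "0 \<le> t" for t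
  proof -
    have "(\<lambda>\<tau>. \<Psi> \<tau> (Y \<tau>) + \<beta> \<tau>) absolutely_integrable_on {0..t}"
      by (rule \<Psi>\<beta>[OF has_integral_imp_continuous_on[OF Y_int]]) auto
    then have "((\<lambda>\<tau>. (- l * exp (- l * \<tau>)) *\<^sub>R Y \<tau> + exp (- l * \<tau>) *\<^sub>R (\<Psi> \<tau> (Y \<tau>) + \<beta> \<tau>)) has_integral
        (exp (- l * t) *\<^sub>R Y t - exp (- l * 0) *\<^sub>R Y 0)) {0..t}"
      using that Y_int Y0
      by (intro has_integral_product_rule)
        (auto intro!: derivative_eq_intros continuous_intros
          simp: has_real_derivative_iff_has_vector_derivative[symmetric])
    then show ?thesis
      by (rule has_integral_eq_rhs[OF has_integral_eq[rotated]])
        (simp_all add: X_def Y0 \<Psi>_def \<beta>_def linear_scale[OF lin] algebra_simps exp_minus)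
  qed
  moreover have "0 \<le> X t" if "0 \<le> t" for t
    using Y_nonneg[OF that] by (simp add: X_def scaleR_nonneg_nonneg)
  ultimately show ?thesis by blast
qed

section \<open>Trajectories\<close>

lemma locally_integrable_bounded:
  fixes f :: "real \<Rightarrow> 'a::euclidean_space"
  assumes "f \<in> borel_measurable borel" "\<And>t. norm (f t) \<le> C"
  shows "locally_integrable f"
  unfolding locally_integrable_def
proof
  fix T
  show "f absolutely_integrable_on {0..T}"
  proof (rule measurable_bounded_by_integrable_imp_absolutely_integrable)
    show "f \<in> borel_measurable (lebesgue_on {0..T})"
      using assms(1) by (intro measurable_restrict_space1 measurable_completion) simp
    show "(\<lambda>_. C) integrable_on {0..T}" by (rule integrable_const_ivl)
  qed (use assms in auto)
qed

lemma trajectoryD: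
  assumes "trajectory A B F H E G x0 x u w v"
  shows "locally_integrable u" "locally_integrable w" "locally_integrable v"
    "\<And>t. 0 \<le> t \<Longrightarrow> ((\<lambda>\<tau>. A *v x \<tau> + B *v u \<tau> + F *v w \<tau> + H *v v \<tau>) has_integral (x t - x0)) {0..t}"
    "\<And>t. 0 \<le> t \<Longrightarrow> \<bar>u t\<bar> \<le> E *v x t" "\<And>t. 0 \<le> t \<Longrightarrow> 0 \<le> w t"
    "\<And>t. 0 \<le> t \<Longrightarrow> \<bar>v t\<bar> \<le> G *v x t"
  using assms by (auto simp: trajectory_def)

lemma trajectory_continuous:
  assumes "trajectory A B F H E G x0 x u w v"
  shows "continuous_on {0..T} x"
  by (rule has_integral_imp_continuous_on[OF trajectoryD(4)[OF assms]]) auto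

lemma trajectory_state_integrable:
  assumes "trajectory A B F H E G x0 x u w v"
  shows "x absolutely_integrable_on {0..T}"
  by (rule absolutely_integrable_continuous_real[OF trajectory_continuous[OF assms]])

lemma trajectory_initial:
  assumes "trajectory A B F H E G x0 x u w v"
  shows "x 0 = x0"
  using trajectoryD(4)[OF assms, of 0] by (auto dest: has_integral_unique simp: has_integral_refl(1))

lemma absolutely_integrable_matrix_vector:
  fixes M :: "real^'n^'m"
  assumes "f absolutely_integrable_on S"
  shows "(\<lambda>t. M *v f t) absolutely_integrable_on S"
  using absolutely_integrable_linear[OF assms matrix_vector_mul_bounded_linear[of M]] by (simp add: o_def)

lemma trajectory_derivative_integrable:
  assumes "trajectory A B F H E G x0 x u w v"
  shows "(\<lambda>\<tau>. A *v x \<tau> + B *v u \<tau> + F *v w \<tau> + H *v v \<tau>) absolutely_integrable_on {0..T}"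
  using trajectoryD(1-3)[OF assms] trajectory_state_integrable[OF assms]
  by (intro set_integral_add(1) absolutely_integrable_matrix_vector) (auto simp: locally_integrable_def)

definition running_cost where
  "running_cost s r \<gamma> \<delta> x u w v \<tau> = s \<bullet> x \<tau> + r \<bullet> u \<tau> - \<gamma> \<bullet> w \<tau> - \<delta> \<bullet> v \<tau>"

lemma running_cost_integrable:
  fixes s :: "real^'n" and r :: "real^'m" and \<gamma> :: "real^'l" and \<delta> :: "real^'c"
  assumes "trajectory A B F H E G x0 x u w v"
  shows "running_cost s r \<gamma> \<delta> x u w v absolutely_integrable_on {0..T}"
proof -
  have *: "(\<lambda>\<tau>. y \<bullet> f \<tau>) absolutely_integrable_on {0..T}"
    if "f absolutely_integrable_on {0..T}" for y :: "real^'k" and f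
    using absolutely_integrable_component[OF that, of y] by (simp add: inner_commute)
  show ?thesis
    unfolding running_cost_def[abs_def]
    using trajectoryD(1-3)[OF assms] trajectory_state_integrable[OF assms]
    by (intro set_integral_add(1) set_integral_diff(1) *) (auto simp: locally_integrable_def)
qed

section \<open>The Bellman operator\<close>

text \<open>One shift \<open>l\<close> is fixed for \<open>M\<close> and its transpose, because it
  also becomes the rate of the exponentials in the value iteration. Products with a transpose appear
  as \<open>x v* M\<close>, the form to which the simplifier brings them.\<close>

locale minimax_problem =
  fixes A :: "real^'n^'n" and B :: "real^'m^'n" and F :: "real^'l^'n" and H :: "real^'c^'n"
    and E :: "real^'n^'m" and G :: "real^'n^'c"
    and s :: "real^'n" and r :: "real^'m" and \<gamma> :: "real^'l" and \<delta> :: "real^'c"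
    and M :: "real^'n^'n" and l :: real
  assumes F: "0 \<le> F" and E: "0 \<le> E" and G: "0 \<le> G"
    and M_eq: "M = A - \<bar>B\<bar> ** E - \<bar>H\<bar> ** G"
    and M: "metzler M"
    and s: "\<bar>r\<bar> v* E - \<bar>\<delta>\<bar> v* G \<le> s"
    and l: "0 < l"
    and M_shift: "\<And>x. 0 \<le> x \<Longrightarrow> 0 \<le> M *v x + l *\<^sub>R x"
    and M_shift_transpose: "\<And>x. 0 \<le> x \<Longrightarrow> 0 \<le> x v* M + l *\<^sub>R x"
begin

abbreviation "traj \<equiv> trajectory A B F H E G"
abbreviation "cost \<equiv> running_cost s r \<gamma> \<delta>"

text \<open>The control and the disturbance \<open>v\<close> can lower the derivative by at most
  \<open>\<bar>B\<bar> *v (E *v x)\<close> and \<open>\<bar>H\<bar> *v (G *v x)\<close>, and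
  \<open>F *v w\<close> can only raise it. This is the differential inequality that keeps
  trajectories in the orthant.\<close>

lemma metzler_lower_bound:
  assumes "\<bar>u\<bar> \<le> E *v x" "0 \<le> w" "\<bar>v\<bar> \<le> G *v x"
  shows "M *v x \<le> A *v x + B *v u + F *v w + H *v v"
proof -
  have "\<bar>B *v u\<bar> \<le> \<bar>B\<bar> *v (E *v x)" "\<bar>H *v v\<bar> \<le> \<bar>H\<bar> *v (G *v x)"
    by (intro order_trans[OF abs_matrix_vector_mult_le] matrix_vector_mult_mono assms; simp)+
  moreover have "0 \<le> F *v w" by (intro matrix_vector_mult_nonneg F assms)
  moreover have "M *v x = A *v x - \<bar>B\<bar> *v (E *v x) - \<bar>H\<bar> *v (G *v x)"
    by (simp add: M_eq matrix_vector_mult_diff_rdistrib matrix_vector_mul_assoc)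
  ultimately show ?thesis
    by (auto simp: less_eq_vec_def abs_vec_nth) (smt (verit))
qed

lemma trajectory_nonneg:
  assumes "traj x0 x u w v" "0 \<le> x0" "0 \<le> t"
  shows "0 \<le> x t"
proof (rule metzler_comparison[OF M assms(2) trajectory_derivative_integrable[OF assms(1), of t]])
  show "t \<in> {0..t}" using assms by simp
qed (use trajectoryD[OF assms(1)] in \<open>auto intro!: metzler_lower_bound\<close>)

text \<open>In \<open>bellman_with d\<close> the disturbance is held at the fixed ratio \<open>d\<close> to its bound.\<close>

definition bellman_with :: "real^'c \<Rightarrow> real^'n \<Rightarrow> real^'n" where
  "bellman_with d p = s + p v* A - \<bar>r + p v* B\<bar> v* E + (d * (p v* H - \<delta>)) v* G"

text \<open>For \<open>x \<ge> 0\<close>, \<open>bellman p \<bullet> x\<close> is the minimum over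
  \<open>u\<close> and maximum over \<open>v\<close> of the running cost plus the derivative of
  \<open>p \<bullet> x\<close>, at \<open>w = 0\<close>.\<close>

definition bellman :: "real^'n \<Rightarrow> real^'n" where
  "bellman p = s + p v* A - \<bar>r + p v* B\<bar> v* E + \<bar>p v* H - \<delta>\<bar> v* G"

lemma bellman_with_sgn: "bellman_with (sgn_vec (p v* H - \<delta>)) p = bellman p"
  by (simp add: bellman_with_def bellman_def sgn_vec_mult)

lemma bellman_with_le:
  assumes "\<bar>d\<bar> \<le> 1"
  shows "bellman_with d p \<le> bellman p"
proof -
  have "d * z \<le> \<bar>z\<bar>" for z :: "real^'c"
    using assms
    by (auto simp: abs_le_iff_vec less_eq_vec_def abs_vec_nth)
      (metis abs_ge_self abs_ge_zero abs_mult mult_left_le_one_le order_trans)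
  then show ?thesis
    unfolding bellman_with_def bellman_def by (intro add_left_mono vector_matrix_mult_mono G)
qed

text \<open>Raising \<open>p\<close> by \<open>z \<ge> 0\<close> changes the control term by at most
  \<open>(z v* \<bar>B\<bar>) v* E\<close> and the disturbance term by at most
  \<open>(z v* \<bar>H\<bar>) v* G\<close>. So \<open>bellman_with d\<close> grows by at least
  \<open>z v* M\<close>, and \<open>l *\<^sub>R z\<close> makes up for a negative part of
  this.\<close>

lemma bellman_with_mono:
  assumes "p \<le> q" "\<bar>d\<bar> \<le> 1"
  shows "bellman_with d p + l *\<^sub>R p \<le> bellman_with d q + l *\<^sub>R q"
proof -
  define z where "z = q - p"
  have z: "0 \<le> z" using assms by (simp add: z_def)
  have "(\<bar>r + q v* B\<bar> - \<bar>r + p v* B\<bar>) v* E \<le> (z v* \<bar>B\<bar>) v* E"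
  proof (rule vector_matrix_mult_mono[OF E])
    have "\<bar>r + q v* B\<bar> - \<bar>r + p v* B\<bar> \<le> \<bar>z v* B\<bar>"
      using abs_triangle_ineq2[of "r + q v* B" "r + p v* B"] by (simp add: z_def vector_matrix_mult_diff)
    also have "\<dots> \<le> z v* \<bar>B\<bar>" using abs_vector_matrix_mult_le[of z B] z by simp
    finally show "\<bar>r + q v* B\<bar> - \<bar>r + p v* B\<bar> \<le> z v* \<bar>B\<bar>" .
  qed
  moreover have "- ((z v* \<bar>H\<bar>) v* G) \<le> (d * (z v* H)) v* G"
  proof -
    have "- (z v* \<bar>H\<bar>) \<le> d * (z v* H)"
    proof -
      have "\<bar>d * y\<bar> \<le> \<bar>y\<bar>" for y :: "real^'c"
        using assms(2) by (auto simp: abs_le_iff_vec abs_vec_nth abs_mult intro: mult_left_le_one_le)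
      then have "\<bar>d * (z v* H)\<bar> \<le> z v* \<bar>H\<bar>"
        using abs_vector_matrix_mult_le[of z H] z by (metis abs_of_nonneg order_trans)
      then show ?thesis by (simp add: abs_le_iff neg_le_iff_le[of _ "z v* \<bar>H\<bar>"] minus_le_iff)
    qed
    from vector_matrix_mult_mono[OF G this] show ?thesis
      by (simp add: linear_neg[OF vector_matrix_mult_linear])
  qed
  moreover have "0 \<le> z v* A - (z v* \<bar>B\<bar>) v* E - (z v* \<bar>H\<bar>) v* G + l *\<^sub>R z"
    using M_shift_transpose[OF z] by (simp add: M_eq vector_matrix_mult_diff_right vector_matrix_mult_assoc)
  moreover have "bellman_with d q - bellman_with d p =
      z v* A - (\<bar>r + q v* B\<bar> - \<bar>r + p v* B\<bar>) v* E + (d * (z v* H)) v* G"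
    by (simp add: bellman_with_def z_def vector_matrix_mult_diff algebra_simps)
  moreover have "l *\<^sub>R z = l *\<^sub>R q - l *\<^sub>R p" by (simp add: z_def algebra_simps)
  ultimately show ?thesis
    unfolding less_eq_vec_def by (simp add: vec_eq_iff) (smt (verit))
qed

text \<open>With the ratio \<open>d\<close> that is worst for \<open>p\<close>,
  \<open>bellman_with d\<close> agrees with \<open>bellman\<close> at \<open>p\<close> and lies
  below it at \<open>q\<close>, so the fixed-ratio monotonicity carries over.\<close>

lemma bellman_mono:
  assumes "p \<le> q"
  shows "bellman p + l *\<^sub>R p \<le> bellman q + l *\<^sub>R q"
  using bellman_with_mono[OF assms abs_sgn_vec_le[of "p v* H - \<delta>"]]
    bellman_with_le[OF abs_sgn_vec_le[of "p v* H - \<delta>"], of q]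
  by (simp add: bellman_with_sgn) (meson add_right_mono order_trans)

text \<open>The hypothesis on \<open>s\<close> says exactly this; it lets the iteration from
  \<open>0\<close> start upwards.\<close>

lemma bellman_zero_nonneg: "0 \<le> bellman 0"
  using s by (simp add: bellman_def algebra_simps)

lemma running_cost_plus_derivative:
  "cost x u w v \<tau> + q \<bullet> (A *v x \<tau> + B *v u \<tau> + F *v w \<tau> + H *v v \<tau>) =
    (s + q v* A) \<bullet> x \<tau> + (r + q v* B) \<bullet> u \<tau> + (q v* F - \<gamma>) \<bullet> w \<tau> + (q v* H - \<delta>) \<bullet> v \<tau>"
  by (simp add: running_cost_def inner_add_left inner_add_right inner_diff_left dot_lmul_matrix)

text \<open>
  The proof differentiates \<open>q t \<bullet> x t\<close> for \<open>q t = p + (1 - exp (- l (b - t))) / l *\<^sub>R bellman p\<close>.  As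
  \<open>q\<close> stays above \<open>p\<close>, monotonicity of \<open>bellman_with d q + l *\<^sub>R q\<close> gives
  \<open>bellman_with d q \<ge> bellman p - l *\<^sub>R (q - p) = - q'\<close>.
\<close>

lemma value_iteration_step:
  assumes tr: "traj x0 x u w v" and x0: "0 \<le> x0" and ab: "0 \<le> a" "a \<le> b"
    and p: "0 \<le> bellman p"
    and v: "\<And>t. t \<in> {a<..<b} \<Longrightarrow> v t = sgn_vec (p v* H - \<delta>) * (G *v x t)"
    and w: "((\<lambda>t. (p v* F - \<gamma>) \<bullet> w t) has_integral W) {a..b}"
  shows "(p + ((1 - exp (- l * (b - a))) / l) *\<^sub>R bellman p) \<bullet> x a + W
           \<le> integral {a..b} (cost x u w v) + p \<bullet> x b"
proof -
  \<comment> \<open>With this \<open>y\<close> the weight is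
    \<open>q t = p + (1 - \<phi> t) *\<^sub>R y\<close>, and \<open>- q'\<close> is
    \<open>(l * \<phi> t) *\<^sub>R y\<close>.\<close>
  define y where "y = (1 / l) *\<^sub>R bellman p"
  have y: "0 \<le> y" "l *\<^sub>R y = bellman p" using p l by (simp_all add: y_def scaleR_nonneg_nonneg)
  define \<phi> where "\<phi> t = exp (l * (t - b))" for t
  define g where "g \<tau> = A *v x \<tau> + B *v u \<tau> + F *v w \<tau> + H *v v \<tau>" for \<tau>
  define d where "d = sgn_vec (p v* H - \<delta>)"
  have gi: "g absolutely_integrable_on {a..b}"
    using ab unfolding g_def[abs_def]
    by (intro absolutely_integrable_on_subinterval[OF trajectory_derivative_integrable[OF tr, of b]]) auto
  have g: "(g has_integral (x t - x a)) {a..t}" if "t \<in> {a..b}" for t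
  proof -
    have "(g has_integral (x a - x0)) {0..a}" "(g has_integral (x t - x0)) {0..t}"
      using trajectoryD(4)[OF tr] ab that unfolding g_def[abs_def] by auto
    moreover have "g integrable_on {a..t}"
      using gi that by (meson absolutely_integrable_on_subinterval atLeastatMost_subset_iff
          atLeastAtMost_iff order_refl set_lebesgue_integral_eq_integral(1))
    moreover have "integral {0..a} g + integral {a..t} g = integral {0..t} g"
      using that ab calculation(2)
      by (intro Henstock_Kurzweil_Integration.integral_combine) auto
    ultimately show ?thesis
      by (metis (no_types, lifting) add_diff_cancel_left' diff_diff_eq2 diff_add_cancel has_integral_integral integral_unique)
  qed
  have "((\<lambda>\<tau>. (l * \<phi> \<tau>) *\<^sub>R x \<tau> + \<phi> \<tau> *\<^sub>R g \<tau>) has_integral (\<phi> b *\<^sub>R x b - \<phi> a *\<^sub>R x a)) {a..b}"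
    using ab g gi unfolding \<phi>_def
    by (intro has_integral_product_rule)
      (auto intro!: derivative_eq_intros continuous_intros
        simp: has_real_derivative_iff_has_vector_derivative[symmetric])
  from has_integral_linear[OF this bounded_linear_inner_right[of y]]
  have 1: "((\<lambda>\<tau>. y \<bullet> ((l * \<phi> \<tau>) *\<^sub>R x \<tau> + \<phi> \<tau> *\<^sub>R g \<tau>)) has_integral (y \<bullet> (x b - \<phi> a *\<^sub>R x a))) {a..b}"
    by (simp add: o_def \<phi>_def)
  have 2: "((\<lambda>\<tau>. (p + y) \<bullet> g \<tau>) has_integral ((p + y) \<bullet> (x b - x a))) {a..b}"
    using has_integral_linear[OF g bounded_linear_inner_right[of "p + y"], of b] ab by (simp add: o_def)
  have "cost x u w v integrable_on {a..b}"
    using running_cost_integrable[OF tr, of b s r \<gamma> \<delta>] ab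
    by (meson absolutely_integrable_on_subinterval atLeastatMost_subset_iff order_refl
        set_lebesgue_integral_eq_integral(1))
  then have 3: "(cost x u w v has_integral integral {a..b} (cost x u w v)) {a..b}"
    by (rule integrable_integral)
  \<comment> \<open>\<open>J\<close> is the running cost plus the derivative of
    \<open>q \<bullet> x\<close>, less the prescribed \<open>w\<close> term. Writing
    \<open>q \<bullet> x\<close> as
    \<open>(p + y) \<bullet> x - y \<bullet> (\<phi> *\<^sub>R x)\<close> leaves only
    \<open>\<phi> *\<^sub>R x\<close> to the product rule.\<close>
  define J where "J \<tau> = cost x u w v \<tau> + (p + y) \<bullet> g \<tau> - y \<bullet> ((l * \<phi> \<tau>) *\<^sub>R x \<tau> + \<phi> \<tau> *\<^sub>R g \<tau>)
      - (p v* F - \<gamma>) \<bullet> w \<tau>" for \<tau>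
  have "(J has_integral (integral {a..b} (cost x u w v) + (p + y) \<bullet> (x b - x a)
      - y \<bullet> (x b - \<phi> a *\<^sub>R x a) - W)) {a..b}"
    unfolding J_def by (intro has_integral_diff has_integral_add 1 2 3 w)
  \<comment> \<open>The form of \<open>v\<close> is known only inside the interval, so the endpoints
    are dropped.\<close>
  then have "(J has_integral (integral {a..b} (cost x u w v) + (p + y) \<bullet> (x b - x a)
      - y \<bullet> (x b - \<phi> a *\<^sub>R x a) - W)) {a<..<b}"
    by (simp add: has_integral_Icc_iff_Ioo)
  moreover have "0 \<le> J \<tau>" if \<tau>: "\<tau> \<in> {a<..<b}" for \<tau>
  proof -
    have \<tau>0: "0 \<le> \<tau>" using that ab by auto
    have x: "0 \<le> x \<tau>" by (rule trajectory_nonneg[OF tr x0 \<tau>0])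
    define q where "q = p + (1 - \<phi> \<tau>) *\<^sub>R y"
    have "\<phi> \<tau> \<le> 1" using l \<tau> by (simp add: \<phi>_def mult_le_0_iff)
    then have pq: "p \<le> q" using y by (simp add: q_def scaleR_nonneg_nonneg)
    have "J \<tau> = (cost x u w v \<tau> + q \<bullet> g \<tau>) - (l * \<phi> \<tau>) * (y \<bullet> x \<tau>) - (p v* F - \<gamma>) \<bullet> w \<tau>"
      by (simp add: J_def q_def inner_add_left inner_add_right algebra_simps)
    also have "\<dots> = (s + q v* A) \<bullet> x \<tau> + (r + q v* B) \<bullet> u \<tau> + ((q - p) v* F) \<bullet> w \<tau>
        + (q v* H - \<delta>) \<bullet> v \<tau> - (l * \<phi> \<tau>) * (y \<bullet> x \<tau>)"
      unfolding g_def running_cost_plus_derivative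
      by (simp add: vector_matrix_mult_diff inner_diff_left)
    finally have J: "J \<tau> = \<dots>" .
    have "0 \<le> ((q - p) v* F) \<bullet> w \<tau>"
      using inner_mono_nonneg[OF vector_matrix_mult_nonneg[OF F, of "q - p"] trajectoryD(6)[OF tr \<tau>0]] pq
      by simp
    moreover have "- ((\<bar>r + q v* B\<bar> v* E) \<bullet> x \<tau>) \<le> (r + q v* B) \<bullet> u \<tau>"
    proof -
      have "\<bar>(r + q v* B) \<bullet> u \<tau>\<bar> \<le> \<bar>r + q v* B\<bar> \<bullet> \<bar>u \<tau>\<bar>" by (rule abs_inner_le)
      also have "\<dots> \<le> \<bar>r + q v* B\<bar> \<bullet> (E *v x \<tau>)"
        using inner_mono_nonneg[OF trajectoryD(5)[OF tr \<tau>0], of "\<bar>r + q v* B\<bar>"] by (simp add: inner_commute)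
      finally show ?thesis by (simp add: dot_lmul_matrix)
    qed
    moreover have "(q v* H - \<delta>) \<bullet> v \<tau> = ((d * (q v* H - \<delta>)) v* G) \<bullet> x \<tau>"
      by (simp add: v[OF \<tau>] d_def inner_vec_mult_commute dot_lmul_matrix)
    ultimately have "bellman_with d q \<bullet> x \<tau> - (l * \<phi> \<tau>) * (y \<bullet> x \<tau>) \<le> J \<tau>"
      unfolding J bellman_with_def by (simp add: inner_add_left inner_diff_left)
    moreover have "(l * \<phi> \<tau>) *\<^sub>R y \<le> bellman_with d q"
    proof -
      have "bellman_with d p + l *\<^sub>R p \<le> bellman_with d q + l *\<^sub>R q"
        by (rule bellman_with_mono[OF pq]) (simp add: d_def abs_sgn_vec_le)
      moreover have "bellman_with d p = l *\<^sub>R y" by (simp add: d_def bellman_with_sgn y)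
      moreover have "l *\<^sub>R q = l *\<^sub>R p + l *\<^sub>R y - (l * \<phi> \<tau>) *\<^sub>R y" by (simp add: q_def algebra_simps)
      ultimately show ?thesis by (simp add: algebra_simps)
    qed
    ultimately show ?thesis
      using inner_mono_nonneg[OF _ x, of "(l * \<phi> \<tau>) *\<^sub>R y" "bellman_with d q"] by simp
  qed
  ultimately have "0 \<le> integral {a..b} (cost x u w v) + (p + y) \<bullet> (x b - x a) - y \<bullet> (x b - \<phi> a *\<^sub>R x a) - W"
    by (rule has_integral_nonneg)
  moreover have eq: "((1 - exp (- l * (b - a))) / l) *\<^sub>R bellman p = (1 - \<phi> a) *\<^sub>R y"
  proof -
    have "- l * (b - a) = l * (a - b)" by (simp add: algebra_simps)
    then show ?thesis by (simp only: y_def \<phi>_def) simp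
  qed
  ultimately show ?thesis
    unfolding eq by (simp add: inner_add_left inner_add_right inner_diff_left inner_diff_right algebra_simps)
qed

section \<open>Value iteration over time intervals of length one\<close>

definition gain :: real where "gain = (1 - exp (- l)) / l"

lemma gain: "0 < gain" "gain * l \<le> 1"
  using l by (simp_all add: gain_def)

definition iterate :: "real^'n \<Rightarrow> real^'n" where
  "iterate p = p + gain *\<^sub>R bellman p"

text \<open>\<open>iterate p\<close> is the combination \<open>gain *\<^sub>R (bellman p + l
  *\<^sub>R p) + (1 - gain * l) *\<^sub>R p\<close> of monotone maps, with nonnegative weights
  because \<open>gain * l \<le> 1\<close>.\<close>

lemma iterate_mono:
  assumes "p \<le> q"
  shows "iterate p \<le> iterate q"
proof -
  have "0 \<le> gain *\<^sub>R ((bellman q + l *\<^sub>R q) - (bellman p + l *\<^sub>R p))"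
    using bellman_mono[OF assms] gain by (intro scaleR_nonneg_nonneg) auto
  moreover have "0 \<le> (1 - gain * l) *\<^sub>R (q - p)"
    using assms gain by (intro scaleR_nonneg_nonneg) auto
  ultimately have "0 \<le> gain *\<^sub>R ((bellman q + l *\<^sub>R q) - (bellman p + l *\<^sub>R p)) + (1 - gain * l) *\<^sub>R (q - p)"
    by (rule add_nonneg_nonneg)
  also have "\<dots> = iterate q - iterate p" by (simp add: iterate_def algebra_simps)
  finally show ?thesis by simp
qed

definition val :: "nat \<Rightarrow> real^'n" where "val k = (iterate ^^ k) 0"

lemma val_0: "val 0 = 0" and val_Suc: "val (Suc k) = iterate (val k)"
  by (simp_all add: val_def)

lemma val_mono_Suc: "val k \<le> val (Suc k)"
proof (induction k)
  case 0
  show ?case using bellman_zero_nonneg gain by (simp add: val_def iterate_def scaleR_nonneg_nonneg)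
next
  case (Suc k)
  then show ?case using iterate_mono by (simp add: val_Suc)
qed

lemma val_nonneg: "0 \<le> val k"
  using lift_Suc_mono_le[of val 0 k, OF val_mono_Suc] by (simp add: val_0)

lemma bellman_val_nonneg: "0 \<le> bellman (val k)"
proof -
  have "0 \<le> gain *\<^sub>R bellman (val k)" using val_mono_Suc[of k] by (simp add: val_Suc iterate_def)
  then show ?thesis using gain by (simp add: less_eq_vec_def zero_le_mult_iff)
qed

text \<open>A zero of \<open>bellman\<close> is a fixed point of the monotone map
  \<open>iterate\<close>, and the iteration starts below it.\<close>

lemma val_le_fixed_point:
  assumes "0 \<le> q" "bellman q = 0"
  shows "val k \<le> q"
proof (induction k)
  case (Suc k)
  then show ?case using iterate_mono[OF Suc] assms by (simp add: val_Suc iterate_def)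
qed (simp add: val_0 assms)

lemma continuous_bellman: "continuous_on UNIV bellman"
proof -
  have *: "continuous_on UNIV (\<lambda>x. h x v* N)" if "continuous_on UNIV h" for N :: "real^'k^'j" and h :: "real^'n \<Rightarrow> real^'j"
    using that linear_continuous_on_compose[OF that vector_matrix_mult_linear] by blast
  have **: "continuous_on UNIV (\<lambda>x. \<bar>h x\<bar>)" if "continuous_on UNIV h" for h :: "real^'n \<Rightarrow> real^'j"
    unfolding abs_vec_def by (intro continuous_intros that continuous_on_vec_lambda)
  show ?thesis
    unfolding bellman_def[abs_def] by (intro continuous_on_add continuous_on_diff continuous_on_const continuous_on_id * **)
qed

text \<open>Bounded increasing components converge. By continuity the limit is a fixed point of
  \<open>iterate\<close>, hence a zero of \<open>bellman\<close> as \<open>gain > 0\<close>.\<close>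

lemma val_converges:
  assumes "\<And>k. val k \<le> c"
  obtains p where "val \<longlonglongrightarrow> p" "0 \<le> p" "bellman p = 0"
proof -
  define p where "p = (\<chi> i. lim (\<lambda>k. val k $ i))"
  have lim: "val \<longlonglongrightarrow> p"
  proof (rule vec_tendstoI)
    fix i
    have "incseq (\<lambda>k. val k $ i)"
      using val_mono_Suc by (intro incseq_SucI) (simp add: less_eq_vec_def)
    moreover have "val k $ i \<le> c $ i" for k using assms[of k] by (simp add: less_eq_vec_def)
    ultimately have "convergent (\<lambda>k. val k $ i)" by (metis convergentI incseq_convergent)
    then show "(\<lambda>k. val k $ i) \<longlonglongrightarrow> p $ i" by (simp add: p_def convergent_LIMSEQ_iff)
  qed
  have "(\<lambda>k. bellman (val k)) \<longlonglongrightarrow> bellman p"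
    using continuous_bellman lim by (auto simp: continuous_on_eq_continuous_at intro: isCont_tendsto_compose)
  then have "(\<lambda>k. val k + gain *\<^sub>R bellman (val k)) \<longlonglongrightarrow> p + gain *\<^sub>R bellman p"
    by (intro tendsto_intros lim)
  moreover have "(\<lambda>k. val k + gain *\<^sub>R bellman (val k)) \<longlonglongrightarrow> p"
    using LIMSEQ_Suc[OF lim] by (simp add: val_Suc iterate_def)
  ultimately have "gain *\<^sub>R bellman p = 0" using LIMSEQ_unique by fastforce
  then have "bellman p = 0" using gain by simp
  moreover have "0 \<le> p"
    using val_nonneg tendsto_lowerbound[OF tendsto_vec_nth[OF lim]]
    by (simp add: less_eq_vec_def)
  ultimately show thesis using that lim by blast
qed

lemma bellman_solution_iff:
  "bellman_solution A B F H E G s r \<gamma> \<delta> p \<longleftrightarrow> 0 \<le> p \<and> bellman p = 0 \<and> p v* F \<le> \<gamma>"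
proof -
  have "\<bar>- \<delta> + p v* H\<bar> = \<bar>p v* H - \<delta>\<bar>" by simp
  moreover have "p v* A = \<bar>r + p v* B\<bar> v* E - \<bar>p v* H - \<delta>\<bar> v* G - s \<longleftrightarrow> bellman p = 0"
    by (auto simp: bellman_def algebra_simps)
  ultimately show ?thesis by (simp add: bellman_solution_def)
qed

section \<open>Value of the game\<close>

text \<open>\<open>c\<close> and \<open>j\<close> stay free for two uses: \<open>c = 0\<close>
  bounds the iterates, while large \<open>c\<close> forces component \<open>j\<close> of
  \<open>val n v* F\<close> to be at most that of \<open>\<gamma>\<close>.\<close>

lemma worst_case_lower_bound:
  assumes \<mu>: "admissible_policy A B F H E G \<mu>" and x0: "0 \<le> x0" and c: "0 \<le> c"
  shows "ereal (val (Suc n) \<bullet> x0 + c * (val n v* F - \<gamma>) $ j)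
    \<le> worst_case_cost A B F H E G s r \<gamma> \<delta> \<mu> x0"
proof -
  \<comment> \<open>Supported on the first interval, where the weight is \<open>val n\<close>, this
    \<open>w\<close> contributes exactly \<open>c * (val n v* F - \<gamma>) $ j\<close>.\<close>
  define w :: "real \<Rightarrow> real^'l" where "w t = (if t < 1 then c *\<^sub>R axis j 1 else 0)" for t
  \<comment> \<open>Truncated subtraction keeps the weight at \<open>val 0\<close> from time
    \<open>n\<close> on.\<close>
  define d where "d t = sgn_vec (val (n - nat \<lfloor>t\<rfloor>) v* H - \<delta>)" for t :: real
  have "locally_integrable w"
  proof (rule locally_integrable_bounded)
    show "w \<in> borel_measurable borel" unfolding w_def[abs_def] by measurable
    show "norm (w t) \<le> c" for t using c by (simp add: w_def)
  qed
  moreover have "0 \<le> w t" for t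
    using c by (auto simp: w_def less_eq_vec_def axis_def)
  moreover have d1: "\<bar>d t\<bar> \<le> 1" for t by (simp add: d_def abs_sgn_vec_le)
  moreover have "locally_integrable d"
  proof (rule locally_integrable_bounded)
    \<comment> \<open>\<open>d\<close> depends on \<open>t\<close> only through a measurable map
      into a discrete space, on which every function is measurable.\<close>
    have "(\<lambda>t::real. nat \<lfloor>t\<rfloor>) \<in> borel \<rightarrow>\<^sub>M count_space UNIV" by measurable
    from measurable_compose[OF this, of "\<lambda>k. sgn_vec (val (n - k) v* H - \<delta>)" borel]
    show "d \<in> borel_measurable borel" by (simp add: d_def[abs_def])
    show "norm (d t) \<le> (\<Sum>i\<in>(UNIV :: 'c set). 1)" for t
      using d1[of t] by (intro order_trans[OF norm_le_l1_cart] sum_mono) (simp add: abs_le_iff_vec)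
  qed
  ultimately obtain x where tr: "traj x0 x (\<lambda>t. \<mu> (x t)) w (\<lambda>t. d t * (G *v x t))"
    using \<mu> x0 unfolding admissible_policy_def by blast
  define f where "f = cost x (\<lambda>t. \<mu> (x t)) w (\<lambda>t. d t * (G *v x t))"
  have fi: "f integrable_on {0..T}" for T
    unfolding f_def using running_cost_integrable[OF tr] set_lebesgue_integral_eq_integral(1) by blast
  have combine: "integral {0..a} f + integral {a..b} f = integral {0..b} f" if "0 \<le> a" "a \<le> b" for a b
    using that fi by (intro Henstock_Kurzweil_Integration.integral_combine) auto
  \<comment> \<open>The start weight \<open>val (Suc (n - k))\<close> is the end weight of the
    preceding interval if \<open>1 \<le> k \<le> n\<close>, so these inequalities chain
    together.\<close>
  have step: "val (Suc (n - k)) \<bullet> x (real k) + W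
      \<le> integral {real k..real (Suc k)} f + val (n - k) \<bullet> x (real (Suc k))"
    if "((\<lambda>t. (val (n - k) v* F - \<gamma>) \<bullet> w t) has_integral W) {real k..real (Suc k)}" for k W
  proof -
    have "(val (n - k) + ((1 - exp (- l * (real (Suc k) - real k))) / l) *\<^sub>R bellman (val (n - k))) \<bullet> x (real k) + W
      \<le> integral {real k..real (Suc k)} f + val (n - k) \<bullet> x (real (Suc k))"
      unfolding f_def
    proof (rule value_iteration_step[OF tr x0 _ _ bellman_val_nonneg _ that])
      fix t assume "t \<in> {real k<..<real (Suc k)}"
      then have "nat \<lfloor>t\<rfloor> = k" by (auto simp: nat_eq_iff floor_eq_iff)
      then show "d t * (G *v x t) = sgn_vec (val (n - k) v* H - \<delta>) * (G *v x t)" by (simp add: d_def)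
    qed auto
    then show ?thesis by (simp add: val_Suc iterate_def gain_def)
  qed
  define S where "S = val (Suc n) \<bullet> x0 + c * (val n v* F - \<gamma>) $ j"
  have S: "S \<le> integral {0..real (Suc i)} f + val (n - i) \<bullet> x (real (Suc i))" if "i \<le> n" for i
    using that
  proof (induction i)
    case 0
    \<comment> \<open>\<open>w\<close> already vanishes at time \<open>1\<close>, so the integral is
      computed on the open interval.\<close>
    have "((\<lambda>t::real. c * (val n v* F - \<gamma>) $ j) has_integral c * (val n v* F - \<gamma>) $ j) {0<..<1}"
      using has_integral_const_real[of "c * (val n v* F - \<gamma>) $ j" 0 1] by (simp add: has_integral_Icc_iff_Ioo)
    then have "((\<lambda>t. (val n v* F - \<gamma>) \<bullet> w t) has_integral c * (val n v* F - \<gamma>) $ j) {0<..<1}"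
      by (rule has_integral_eq[rotated]) (simp add: w_def inner_axis)
    then show ?case
      using step[of 0] by (simp add: S_def trajectory_initial[OF tr] has_integral_Icc_iff_Ioo)
  next
    case (Suc i)
    have "((\<lambda>t. (val (n - Suc i) v* F - \<gamma>) \<bullet> w t) has_integral 0) {real (Suc i)..real (Suc (Suc i))}"
      by (rule has_integral_is_0) (auto simp: w_def)
    from step[OF this] show ?case
      using Suc combine[of "real (Suc i)" "real (Suc (Suc i))"] by (simp add: Suc_diff_Suc)
  qed
  \<comment> \<open>The upper limit calls for a bound at all late horizons. After time
    \<open>Suc n\<close> the end weight is \<open>val 0 = 0\<close>, and
    \<open>bellman 0 \<ge> 0\<close> makes the remaining cost nonnegative.\<close>
  have "S \<le> integral {0..T} f" if T: "real (Suc n) \<le> T" for T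
  proof -
    have "(val 0 + ((1 - exp (- l * (T - real (Suc n)))) / l) *\<^sub>R bellman (val 0)) \<bullet> x (real (Suc n)) + 0
      \<le> integral {real (Suc n)..T} f + val 0 \<bullet> x T"
      unfolding f_def
    proof (rule value_iteration_step[OF tr x0 _ T bellman_val_nonneg])
      show "((\<lambda>t. (val 0 v* F - \<gamma>) \<bullet> w t) has_integral 0) {real (Suc n)..T}"
        by (rule has_integral_is_0) (auto simp: w_def)
      fix t assume "t \<in> {real (Suc n)<..<T}"
      then have "n - nat \<lfloor>t\<rfloor> = 0" by (simp add: le_nat_floor)
      then show "d t * (G *v x t) = sgn_vec (val 0 v* H - \<delta>) * (G *v x t)" by (simp add: d_def)
    qed auto
    moreover have "0 \<le> ((1 - exp (- l * (T - real (Suc n)))) / l) *\<^sub>R bellman (val 0)"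
      using l T bellman_val_nonneg[of 0] by (intro scaleR_nonneg_nonneg) auto
    then have "0 \<le> (((1 - exp (- l * (T - real (Suc n)))) / l) *\<^sub>R bellman (val 0)) \<bullet> x (real (Suc n))"
      using inner_mono_nonneg[OF _ trajectory_nonneg[OF tr x0, of "real (Suc n)"]] by fastforce
    ultimately show ?thesis
      using S[of n] combine[of "real (Suc n)" T] T by (simp add: val_0)
  qed
  then have "\<forall>\<^sub>F T in at_top. ereal S \<le> ereal (integral {0..T} f)"
    by (intro eventually_at_top_linorderI[of "real (Suc n)"]) simp
  then have "ereal S \<le> total_cost s r \<gamma> \<delta> x (\<lambda>t. \<mu> (x t)) w (\<lambda>t. d t * (G *v x t))"
    unfolding total_cost_def f_def running_cost_def by (intro le_Limsup) auto
  also have "\<dots> \<le> worst_case_cost A B F H E G s r \<gamma> \<delta> \<mu> x0"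
    unfolding worst_case_cost_def using tr by (intro Sup_upper) blast
  finally show ?thesis by (simp add: S_def)
qed

section \<open>Greedy feedback: admissibility and upper bound\<close>

definition greedy_gain :: "real^'n \<Rightarrow> real^'n^'m \<Rightarrow> bool" where
  "greedy_gain p K \<longleftrightarrow> (\<forall>i. \<exists>\<sigma>\<in>sign_set (r $ i + p \<bullet> column i B). row i K = \<sigma> *\<^sub>R row i E)"

lemma greedy_gain_exists: "\<exists>K. greedy_gain p K"
proof
  show "greedy_gain p (\<chi> i. sgn (r $ i + p \<bullet> column i B) *\<^sub>R row i E)"
    unfolding greedy_gain_def
  proof
    fix i
    have "sgn y \<in> sign_set y" for y :: real by (simp add: sign_set_def sgn_if)
    then show "\<exists>\<sigma>\<in>sign_set (r $ i + p \<bullet> column i B).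
        row i (\<chi> i. sgn (r $ i + p \<bullet> column i B) *\<^sub>R row i E) = \<sigma> *\<^sub>R row i E"
      by (intro bexI[of _ "sgn (r $ i + p \<bullet> column i B)"]) (simp_all add: row_def vec_eq_iff)
  qed
qed

text \<open>Any choice from the set-valued sign satisfies
  \<open>\<sigma> * y = \<bar>y\<bar>\<close>, also at \<open>y = 0\<close>, where
  \<open>\<sigma>\<close> is free in the unit interval around \<open>0\<close>.\<close>

lemma greedy_gainE:
  assumes "greedy_gain p K"
  obtains \<sigma> where "\<And>i x. (K *v x) $ i = \<sigma> i * (E *v x) $ i" "\<And>i. \<bar>\<sigma> i\<bar> \<le> 1"
    "\<And>i. \<sigma> i * (r + p v* B) $ i = \<bar>(r + p v* B) $ i\<bar>"
proof -
  obtain \<sigma> where \<sigma>: "\<And>i. \<sigma> i \<in> sign_set (r $ i + p \<bullet> column i B)" "\<And>i. row i K = \<sigma> i *\<^sub>R row i E"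
    using assms unfolding greedy_gain_def by metis
  have "(p v* B) $ i = p \<bullet> column i B" for i
    by (simp add: vector_matrix_mult_def inner_vec_def column_def mult.commute)
  then have z: "(r + p v* B) $ i = r $ i + p \<bullet> column i B" for i by simp
  show thesis
  proof
    show "(K *v x) $ i = \<sigma> i * (E *v x) $ i" for i x
      using \<sigma>(2)[of i] by (simp add: matrix_vector_mul_component row_def)
    show "\<bar>\<sigma> i\<bar> \<le> 1" "\<sigma> i * (r + p v* B) $ i = \<bar>(r + p v* B) $ i\<bar>" for i
      using \<sigma>(1)[of i] unfolding z by (auto simp: sign_set_def split: if_splits)
  qed
qed

lemma greedy_abs_le:
  assumes "greedy_gain p K" "0 \<le> x"
  shows "\<bar>K *v x\<bar> \<le> E *v x"
proof -
  from assms(1) obtain \<sigma> where "\<And>i x. (K *v x) $ i = \<sigma> i * (E *v x) $ i" "\<And>i. \<bar>\<sigma> i\<bar> \<le> 1"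
    by (rule greedy_gainE) blast
  then show ?thesis
    using matrix_vector_mult_nonneg[OF E assms(2)]
    by (auto simp: abs_le_iff_vec abs_vec_nth abs_mult less_eq_vec_def intro: mult_left_le_one_le)
qed

text \<open>For a prescribed ratio \<open>d\<close> the closed loop is linear in the state with
  time-dependent coefficients. It dominates \<open>M *v x\<close>, so it is positive after the shift
  by \<open>l\<close> and has a nonnegative solution, on which the constraints hold.\<close>

lemma greedy_admissible:
  assumes K: "greedy_gain p K"
  shows "admissible_policy A B F H E G (\<lambda>x. - (K *v x))"
  unfolding admissible_policy_def
proof (intro conjI allI impI)
  show "\<bar>- (K *v x)\<bar> \<le> E *v x" if "0 \<le> x" for x
    using greedy_abs_le[OF K that] by simp
next
  fix x0 :: "real^'n" and w :: "real \<Rightarrow> real^'l" and d :: "real \<Rightarrow> real^'c"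
  assume x0: "0 \<le> x0"
    and wd: "locally_integrable w \<and> (\<forall>t\<ge>0. 0 \<le> w t) \<and> locally_integrable d \<and> (\<forall>t\<ge>0. \<bar>d t\<bar> \<le> 1)"
  define \<Phi> where "\<Phi> t x = A *v x + B *v (- (K *v x)) + H *v (d t * (G *v x))" for t x
  define one :: "real^'n" where "one = (\<chi> i. 1)"
  have one: "0 \<le> one" by (simp add: one_def less_eq_vec_def)
  have dG: "\<bar>d t * (G *v x)\<bar> \<le> G *v x" if "0 \<le> t" "0 \<le> x" for t x
    using wd that matrix_vector_mult_nonneg[OF G that(2)]
    by (auto simp: abs_le_iff_vec abs_vec_nth abs_mult less_eq_vec_def intro: mult_left_le_one_le)
  \<comment> \<open>The continuous factor is the state and the merely integrable one is
    \<open>d\<close>, hence the order of the arguments of \<open>h\<close>.\<close>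
  have Gd: "(\<lambda>t. d t * (G *v y t)) absolutely_integrable_on {0..T}" if "continuous_on {0..T} y" for y T
  proof (rule absolutely_integrable_bilinear_continuous[where h = "\<lambda>x y. y * (G *v x)"])
    show "bilinear (\<lambda>x y :: real^'c. y * (G *v x))"
      unfolding bilinear_def
      by (auto intro!: linearI simp: algebra_simps matrix_vector_right_distrib matrix_vector_mult_scaleR)
  qed (use that wd in \<open>auto simp: locally_integrable_def\<close>)
  \<comment> \<open>A bound on \<open>\<Phi> t one\<close> independent of \<open>t\<close>, as
    \<open>\<bar>d t\<bar> \<le> 1\<close>; the sum of its components bounds all rows at
    once.\<close>
  define c where "c = \<bar>A *v one\<bar> + \<bar>B *v (- (K *v one))\<bar> + \<bar>H\<bar> *v (G *v one)"
  have "\<exists>X. \<forall>t\<ge>0. 0 \<le> X t \<and> ((\<lambda>\<tau>. \<Phi> \<tau> (X \<tau>) + F *v w \<tau>) has_integral (X t - x0)) {0..t}"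
  proof (rule positive_linear_system_solution[where l = l and C = "(\<Sum>i\<in>UNIV. c $ i) + l"
        and \<Phi> = \<Phi> and b = "\<lambda>t. F *v w t"])
    show "linear (\<Phi> t)" for t
      unfolding \<Phi>_def[abs_def]
      by (rule linearI) (simp_all add: algebra_simps matrix_vector_right_distrib matrix_vector_mult_scaleR
          linear_neg[OF matrix_vector_mul_linear])
    show "0 \<le> \<Phi> t x + l *\<^sub>R x" if "0 \<le> t" "0 \<le> x" for t x
    proof -
      have "M *v x \<le> \<Phi> t x"
        using metzler_lower_bound[of "- (K *v x)" x 0 "d t * (G *v x)"] greedy_abs_le[OF K that(2)] dG[OF that]
        by (simp add: \<Phi>_def)
      then show ?thesis using M_shift[OF that(2)] by (meson add_right_mono order_trans)
    qed
    show "\<Phi> t (\<chi> i. 1) $ i + l \<le> (\<Sum>i\<in>UNIV. c $ i) + l" if "0 \<le> t" for t i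
    proof -
      have "\<bar>H *v (d t * (G *v one))\<bar> \<le> \<bar>H\<bar> *v (G *v one)"
        by (intro order_trans[OF abs_matrix_vector_mult_le] matrix_vector_mult_mono dG that one) simp
      then have "\<Phi> t one \<le> c"
        unfolding \<Phi>_def c_def by (intro add_mono abs_ge_self) (meson abs_ge_self order_trans)
      moreover have "0 \<le> c"
        unfolding c_def by (intro add_nonneg_nonneg matrix_vector_mult_nonneg G one) auto
      then have "c $ i \<le> (\<Sum>i\<in>UNIV. c $ i)"
        by (intro member_le_sum) (auto simp: less_eq_vec_def)
      ultimately show ?thesis
        unfolding one_def[symmetric] less_eq_vec_def by (meson add_right_mono order_trans)
    qed
    show "(\<lambda>t. \<Phi> t (y t)) absolutely_integrable_on {0..T}" if "continuous_on {0..T} y" for T y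
      unfolding \<Phi>_def
      by (intro set_integral_add(1) absolutely_integrable_matrix_vector Gd that
          absolutely_integrable_continuous_real continuous_on_minus
          linear_continuous_on_compose[OF that matrix_vector_mul_linear])
    show "(\<lambda>t. F *v w t) absolutely_integrable_on {0..T}" for T
      using wd by (intro absolutely_integrable_matrix_vector) (auto simp: locally_integrable_def)
    show "0 \<le> F *v w t" if "0 \<le> t" for t
      using wd that by (intro matrix_vector_mult_nonneg F) auto
  qed (rule x0)
  then obtain X where X: "\<And>t. 0 \<le> t \<Longrightarrow> 0 \<le> X t"
    "\<And>t. 0 \<le> t \<Longrightarrow> ((\<lambda>\<tau>. \<Phi> \<tau> (X \<tau>) + F *v w \<tau>) has_integral (X t - x0)) {0..t}" by blast
  have cX: "continuous_on {0..T} X" for T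
    by (rule has_integral_imp_continuous_on[OF X(2)]) auto
  have "traj x0 X (\<lambda>t. - (K *v X t)) w (\<lambda>t. d t * (G *v X t))"
    unfolding trajectory_def
  proof (intro conjI allI impI)
    show "locally_integrable (\<lambda>t. - (K *v X t))"
      unfolding locally_integrable_def
      by (intro allI absolutely_integrable_continuous_real continuous_on_minus
          linear_continuous_on_compose[OF cX matrix_vector_mul_linear])
    show "locally_integrable (\<lambda>t. d t * (G *v X t))"
      unfolding locally_integrable_def by (intro allI Gd cX)
    show "((\<lambda>\<tau>. A *v X \<tau> + B *v - (K *v X \<tau>) + F *v w \<tau> + H *v (d \<tau> * (G *v X \<tau>)))
        has_integral X t - x0) {0..t}" if "0 \<le> t" for t
      using X(2)[OF that] by (simp add: \<Phi>_def add_ac)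
    show "\<bar>- (K *v X t)\<bar> \<le> E *v X t" "\<bar>d t * (G *v X t)\<bar> \<le> G *v X t" if "0 \<le> t" for t
      using greedy_abs_le[OF K X(1)[OF that]] dG[OF that X(1)[OF that]] by simp_all
  qed (use wd in auto)
  then show "\<exists>x. traj x0 x (\<lambda>t. - (K *v x t)) w (\<lambda>t. d t * (G *v x t))" by blast
qed

lemma greedy_upper_bound:
  assumes p: "bellman_solution A B F H E G s r \<gamma> \<delta> p" and K: "greedy_gain p K" and x0: "0 \<le> x0"
  shows "worst_case_cost A B F H E G s r \<gamma> \<delta> (\<lambda>x. - (K *v x)) x0 \<le> ereal (p \<bullet> x0)"
  unfolding worst_case_cost_def
proof (rule Sup_least)
  have p0: "0 \<le> p" and fp: "bellman p = 0" and pF: "p v* F \<le> \<gamma>" using p by (simp_all add: bellman_solution_iff)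
  fix z assume "z \<in> {total_cost s r \<gamma> \<delta> x (\<lambda>t. - (K *v x t)) w v | x w v. traj x0 x (\<lambda>t. - (K *v x t)) w v}"
  then obtain x w v where tr: "traj x0 x (\<lambda>t. - (K *v x t)) w v"
    and z: "z = total_cost s r \<gamma> \<delta> x (\<lambda>t. - (K *v x t)) w v" by blast
  obtain \<sigma> where \<sigma>: "\<And>i x. (K *v x) $ i = \<sigma> i * (E *v x) $ i"
    "\<And>i. \<sigma> i * (r + p v* B) $ i = \<bar>(r + p v* B) $ i\<bar>" using greedy_gainE[OF K] by metis
  define f where "f = cost x (\<lambda>t. - (K *v x t)) w v"
  have "integral {0..T} f \<le> p \<bullet> x0" if T: "0 \<le> T" for T
  proof -
    define g where "g \<tau> = A *v x \<tau> + B *v (- (K *v x \<tau>)) + F *v w \<tau> + H *v v \<tau>" for \<tau>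
    have "(f has_integral integral {0..T} f) {0..T}"
      unfolding f_def using running_cost_integrable[OF tr] set_lebesgue_integral_eq_integral(1) by blast
    moreover have "((\<lambda>\<tau>. p \<bullet> g \<tau>) has_integral (p \<bullet> (x T - x0))) {0..T}"
      using has_integral_linear[OF trajectoryD(4)[OF tr T] bounded_linear_inner_right[of p]]
      by (simp add: o_def g_def)
    ultimately have "((\<lambda>\<tau>. f \<tau> + p \<bullet> g \<tau>) has_integral (integral {0..T} f + p \<bullet> (x T - x0))) {0..T}"
      by (rule has_integral_add)
    moreover have "f \<tau> + p \<bullet> g \<tau> \<le> 0" if "\<tau> \<in> {0..T}" for \<tau>
    proof -
      have \<tau>0: "0 \<le> \<tau>" using that by simp
      \<comment> \<open>The feedback attains the minimum of the control term over all
        \<open>u\<close> with \<open>\<bar>u\<bar> \<le> E *v x\<close>.\<close>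
      have "(r + p v* B) \<bullet> (- (K *v x \<tau>)) = - (\<Sum>i\<in>UNIV. (\<sigma> i * (r + p v* B) $ i) * (E *v x \<tau>) $ i)"
        unfolding inner_vec_def by (simp add: \<sigma>(1) sum_negf mult_ac)
      also have "\<dots> = - ((\<bar>r + p v* B\<bar> v* E) \<bullet> x \<tau>)"
        unfolding \<sigma>(2) dot_lmul_matrix by (simp add: inner_vec_def abs_vec_nth)
      finally have 1: "(r + p v* B) \<bullet> (- (K *v x \<tau>)) = - ((\<bar>r + p v* B\<bar> v* E) \<bullet> x \<tau>)" .
      have 2: "(p v* F - \<gamma>) \<bullet> w \<tau> \<le> 0"
        using inner_mono_nonneg[OF pF trajectoryD(6)[OF tr \<tau>0]] by (simp add: inner_diff_left)
      have 3: "(p v* H - \<delta>) \<bullet> v \<tau> \<le> (\<bar>p v* H - \<delta>\<bar> v* G) \<bullet> x \<tau>"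
        using inner_le_abs_inner[OF trajectoryD(7)[OF tr \<tau>0]] by (simp add: dot_lmul_matrix)
      have "f \<tau> + p \<bullet> g \<tau> = (s + p v* A) \<bullet> x \<tau> + (r + p v* B) \<bullet> (- (K *v x \<tau>))
          + (p v* F - \<gamma>) \<bullet> w \<tau> + (p v* H - \<delta>) \<bullet> v \<tau>"
        unfolding f_def g_def by (rule running_cost_plus_derivative)
      also have "\<dots> \<le> bellman p \<bullet> x \<tau>"
        unfolding 1 bellman_def using 2 3 by (simp add: inner_add_left inner_diff_left)
      finally have "f \<tau> + p \<bullet> g \<tau> \<le> bellman p \<bullet> x \<tau>" .
      then show ?thesis by (simp add: fp)
    qed
    ultimately have "integral {0..T} f + p \<bullet> (x T - x0) \<le> 0"
      using has_integral_le[OF _ has_integral_0] by blast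
    moreover have "0 \<le> p \<bullet> x T"
      using inner_mono_nonneg[OF p0 trajectory_nonneg[OF tr x0 T]] by simp
    ultimately show ?thesis by (simp add: inner_diff_right)
  qed
  then have "\<forall>\<^sub>F T in at_top. ereal (integral {0..T} f) \<le> ereal (p \<bullet> x0)"
    by (intro eventually_at_top_linorderI[of 0]) simp
  then show "z \<le> ereal (p \<bullet> x0)"
    unfolding z total_cost_def f_def running_cost_def by (intro Limsup_bounded)
qed

section \<open>The limit of the iterates, the minimal solution and the value\<close>

lemma minimax_value_lower_bound:
  assumes "0 \<le> x0" "0 \<le> c"
  shows "ereal (val (Suc n) \<bullet> x0 + c * (val n v* F - \<gamma>) $ j) \<le> minimax_value A B F H E G s r \<gamma> \<delta> x0"
  unfolding minimax_value_def by (intro INF_greatest worst_case_lower_bound assms) simp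

text \<open>The limit inherits the bound by \<open>\<gamma>\<close>, and it is minimal because the
  iterates lie below every solution.\<close>

lemma val_bounded_imp_minimal_solution:
  assumes c: "\<And>k. val k \<le> c" and F: "\<And>k. val k v* F \<le> \<gamma>"
  obtains p where "minimal_bellman_solution A B F H E G s r \<gamma> \<delta> p" "val \<longlonglongrightarrow> p"
proof -
  obtain p where p: "val \<longlonglongrightarrow> p" "0 \<le> p" "bellman p = 0" using val_converges[OF c] by metis
  have "(\<lambda>k. val k v* F) \<longlonglongrightarrow> p v* F"
    by (rule bounded_linear.tendsto[OF linear_conv_bounded_linear[THEN iffD1, OF vector_matrix_mult_linear] p(1)])
  then have "p v* F \<le> \<gamma>"
    using F tendsto_upperbound[OF tendsto_vec_nth] unfolding less_eq_vec_def by fastforce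
  moreover have "p \<le> q" if "bellman_solution A B F H E G s r \<gamma> \<delta> q" for q
  proof -
    have "val k \<le> q" for k using val_le_fixed_point that by (simp add: bellman_solution_iff)
    then show ?thesis
      using tendsto_upperbound[OF tendsto_vec_nth[OF p(1)]] by (simp add: less_eq_vec_def)
  qed
  ultimately have "minimal_bellman_solution A B F H E G s r \<gamma> \<delta> p"
    using p unfolding minimal_bellman_solution_def bellman_solution_iff by blast
  then show thesis using that p(1) by blast
qed

text \<open>The lower bounds \<open>val (Suc n) \<bullet> x0\<close> tend to
  \<open>p \<bullet> x0\<close>, and greedy feedback costs no more than that, so value and greedy
  cost are squeezed together.\<close>

lemma minimax_value_eq:
  assumes p: "minimal_bellman_solution A B F H E G s r \<gamma> \<delta> p" and x0: "0 \<le> x0"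
  shows "minimax_value A B F H E G s r \<gamma> \<delta> x0 = ereal (p \<bullet> x0)"
    and "greedy_gain p K \<Longrightarrow>
      worst_case_cost A B F H E G s r \<gamma> \<delta> (\<lambda>x. - (K *v x)) x0 = ereal (p \<bullet> x0)"
proof -
  have sol: "bellman_solution A B F H E G s r \<gamma> \<delta> p"
    using p by (simp add: minimal_bellman_solution_def)
  then have p': "0 \<le> p" "bellman p = 0" "p v* F \<le> \<gamma>" by (simp_all add: bellman_solution_iff)
  have le: "val k \<le> p" for k by (rule val_le_fixed_point[OF p'(1,2)])
  have "val k v* F \<le> \<gamma>" for k
    by (rule order_trans[OF vector_matrix_mult_mono[OF F le] p'(3)])
  from val_bounded_imp_minimal_solution[OF le this]
  obtain q where q: "minimal_bellman_solution A B F H E G s r \<gamma> \<delta> q" "val \<longlonglongrightarrow> q" by blast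
  \<comment> \<open>Two minimal solutions lie below each other, so the given \<open>p\<close> is the
    limit of \<open>val\<close>.\<close>
  have "q = p" using p q(1) unfolding minimal_bellman_solution_def by (meson order_antisym)
  then have lim: "(\<lambda>n. ereal (val (Suc n) \<bullet> x0)) \<longlonglongrightarrow> ereal (p \<bullet> x0)"
    using LIMSEQ_Suc[OF q(2)] by (intro tendsto_intros) auto
  \<comment> \<open>Taken with \<open>c = 0\<close>, for which the index \<open>j\<close> does not
    matter.\<close>
  have "ereal (val (Suc n) \<bullet> x0) \<le> minimax_value A B F H E G s r \<gamma> \<delta> x0" for n
    using minimax_value_lower_bound[OF x0 order_refl, of n undefined] by simp
  then have lower: "ereal (p \<bullet> x0) \<le> minimax_value A B F H E G s r \<gamma> \<delta> x0"
    by (intro LIMSEQ_le_const2[OF lim]) blast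
  have upper: "minimax_value A B F H E G s r \<gamma> \<delta> x0 \<le> worst_case_cost A B F H E G s r \<gamma> \<delta> (\<lambda>x. - (K *v x)) x0"
    if "greedy_gain p K" for K
    unfolding minimax_value_def using greedy_admissible[OF that] by (intro INF_lower) simp
  obtain K0 where "greedy_gain p K0" using greedy_gain_exists by blast
  then show "minimax_value A B F H E G s r \<gamma> \<delta> x0 = ereal (p \<bullet> x0)"
    using lower upper greedy_upper_bound[OF sol _ x0] by (meson order_antisym order_trans)
  show "worst_case_cost A B F H E G s r \<gamma> \<delta> (\<lambda>x. - (K *v x)) x0 = ereal (p \<bullet> x0)" if "greedy_gain p K"
    using lower upper[OF that] greedy_upper_bound[OF sol that x0] by (meson order_antisym order_trans)
qed

lemma finite_value_imp_minimal_solution: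
  assumes fin: "\<And>x0. 0 \<le> x0 \<Longrightarrow> \<bar>minimax_value A B F H E G s r \<gamma> \<delta> x0\<bar> \<noteq> \<infinity>"
  obtains p where "minimal_bellman_solution A B F H E G s r \<gamma> \<delta> p"
proof -
  have "\<exists>y. \<forall>n j c. 0 \<le> c \<longrightarrow> val (Suc n) \<bullet> x0 + c * (val n v* F - \<gamma>) $ j \<le> y" if x0: "0 \<le> x0" for x0
  proof -
    obtain y where "minimax_value A B F H E G s r \<gamma> \<delta> x0 = ereal y"
      using fin[OF x0] by auto
    then show ?thesis using minimax_value_lower_bound[OF x0] by (metis ereal_less_eq(3))
  qed
  then obtain y where y: "\<And>x0 n j c. 0 \<le> x0 \<Longrightarrow> 0 \<le> c \<Longrightarrow> val (Suc n) \<bullet> x0 + c * (val n v* F - \<gamma>) $ j \<le> y x0"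
    by metis
  \<comment> \<open>Initial states along the coordinate axes read off the components of the
    iterates.\<close>
  have bound: "val k \<le> (\<chi> i. y (axis i 1))" for k
  proof -
    have "val (Suc k) $ i \<le> y (axis i 1)" for i
    proof -
      have "0 \<le> (axis i 1 :: real^'n)" by (simp add: less_eq_vec_def axis_def)
      from y[OF this order_refl, of k undefined] show ?thesis by (simp add: inner_axis)
    qed
    then have "val (Suc k) \<le> (\<chi> i. y (axis i 1))" by (simp add: less_eq_vec_def)
    then show ?thesis by (rule order_trans[OF val_mono_Suc])
  qed
  have "val k v* F \<le> \<gamma>" for k
  proof (rule ccontr)
    assume "\<not> val k v* F \<le> \<gamma>"
    then obtain j where j: "0 < (val k v* F - \<gamma>) $ j" by (auto simp: less_eq_vec_def not_le)
    \<comment> \<open>At the initial state \<open>0\<close> the term with \<open>val\<close>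
      vanishes, and this \<open>c\<close> lifts the lower bound to
      \<open>\<bar>y 0\<bar> + 1\<close>, above the value.\<close>
    define c where "c = (\<bar>y 0\<bar> + 1) / (val k v* F - \<gamma>) $ j"
    have "c * (val k v* F - \<gamma>) $ j = \<bar>y 0\<bar> + 1" using j by (simp add: c_def)
    moreover have "0 \<le> c" using j by (simp add: c_def)
    ultimately show False using y[of 0 c k j] by simp
  qed
  from val_bounded_imp_minimal_solution[OF bound this] show thesis using that by blast
qed

end

theorem theorem3:
  fixes A :: "real^'n^'n" and B :: "real^'m^'n" and F :: "real^'l^'n" and H :: "real^'c^'n"
    and E :: "real^'n^'m" and G :: "real^'n^'c"
    and s :: "real^'n" and r :: "real^'m" and \<gamma> :: "real^'l" and \<delta> :: "real^'c"
  assumes "0 \<le> F" and "0 \<le> E" and "\<forall>i. row i E \<noteq> 0" and "0 \<le> G" and "0 \<le> \<gamma>"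
    and "metzler (A - \<bar>B\<bar> ** E - \<bar>H\<bar> ** G)"
    and "transpose E *v \<bar>r\<bar> - transpose G *v \<bar>\<delta>\<bar> \<le> s"
  shows
    "((\<forall>x0\<ge>0. \<bar>minimax_value A B F H E G s r \<gamma> \<delta> x0\<bar> \<noteq> \<infinity>) \<longleftrightarrow>
        (\<exists>!p. minimal_bellman_solution A B F H E G s r \<gamma> \<delta> p)) \<and>
     (\<forall>p. minimal_bellman_solution A B F H E G s r \<gamma> \<delta> p \<longrightarrow>
        (\<forall>x0\<ge>0. minimax_value A B F H E G s r \<gamma> \<delta> x0 = ereal (p \<bullet> x0)) \<and>
        (\<forall>K :: real^'n^'m.
           (\<forall>i. \<exists>\<sigma>\<in>sign_set (r $ i + p \<bullet> column i B). row i K = \<sigma> *\<^sub>R row i E) \<longrightarrow>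
           optimal_policy A B F H E G s r \<gamma> \<delta> (\<lambda>x. - (K *v x))))"
proof -
  obtain l where l: "0 < l" "\<And>x. 0 \<le> x \<Longrightarrow> 0 \<le> (A - \<bar>B\<bar> ** E - \<bar>H\<bar> ** G) *v x + l *\<^sub>R x"
    "\<And>x. 0 \<le> x \<Longrightarrow> 0 \<le> transpose (A - \<bar>B\<bar> ** E - \<bar>H\<bar> ** G) *v x + l *\<^sub>R x"
    using metzler_shift[OF assms(6)] by metis
  interpret minimax_problem A B F H E G s r \<gamma> \<delta> "A - \<bar>B\<bar> ** E - \<bar>H\<bar> ** G" l
    using assms l by unfold_locales simp_all
  let ?min = "minimal_bellman_solution A B F H E G s r \<gamma> \<delta>"
  let ?val = "minimax_value A B F H E G s r \<gamma> \<delta>"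
  have finite: "(\<forall>x0\<ge>0. \<bar>?val x0\<bar> \<noteq> \<infinity>) \<longleftrightarrow> (\<exists>!p. ?min p)"
  proof
    assume "\<forall>x0\<ge>0. \<bar>?val x0\<bar> \<noteq> \<infinity>"
    then obtain p where p: "?min p" using finite_value_imp_minimal_solution by blast
    then show "\<exists>!p. ?min p"
      unfolding minimal_bellman_solution_def by (intro ex1I[of _ p]) (auto intro: order_antisym)
  next
    assume "\<exists>!p. ?min p"
    then obtain p where "?min p" by blast
    from minimax_value_eq(1)[OF this] show "\<forall>x0\<ge>0. \<bar>?val x0\<bar> \<noteq> \<infinity>" by simp
  qed
  have optimal: "optimal_policy A B F H E G s r \<gamma> \<delta> (\<lambda>x. - (K *v x))"
    if p: "?min p"
      and K: "\<forall>i. \<exists>\<sigma>\<in>sign_set (r $ i + p \<bullet> column i B). row i K = \<sigma> *\<^sub>R row i E" for p K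
  proof -
    have "greedy_gain p K" using K by (simp add: greedy_gain_def)
    then show ?thesis
      using minimax_value_eq[OF p] greedy_admissible by (simp add: optimal_policy_def)
  qed
  show ?thesis
    using finite minimax_value_eq(1) optimal by blast
qed

end
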